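(* Let $(A_n)_{n\ge1}$ be a strictly stationary, ergodic process of random $p\times p$ nonnegative column-allowable matrices that is weakly sequentially primitive and satisfies $\mathbb E\log^+\|A_1\|<\infty$. Let $\lambda_1\ge\lambda_2$ be its first two Lyapunov exponents, let $M_n=A_nA_{n-1}\cdots A_1$, assume $\lambda_1-\lambda_2>0$, and assume that for any pair of row indices $i,j$ and any column index $k$ the process $M_n^{ik}/M_n^{jk}$ is weakly subexponential. Let $v^1$ be the random row vector that is the almost sure limit of the leading right singular vectors of $M_n$. Then for all pairs of nonnegative vectors $(x,w)\in\mathbb R^p_+\times\mathbb R^p_+$ with $x,w\ne0$, except perhaps for a set of Lebesgue measure zero, it almost surely holds that $$\limsup_{n\to\infty}\frac1n\log\max_{i:\ e_i^\top M_n\neq0}\left|\frac{e_i^\top M_nx}{e_i^\top M_nw}-\frac{v^1x}{v^1w}\right|=-(\lambda_1-\lambda_2).$$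
   Context: $\mathbb R^p_+$ denotes the set of nonnegative, nonzero vectors of $\mathbb R^p$; $e_i$ is the $i$th unit vector; $M_n^{ik}$ is the $(i,k)$ entry of $M_n$; $\log0=-\infty$. A nonnegative matrix is column-allowable if each of its columns contains a strictly positive entry. A strictly stationary process of nonnegative column-allowable matrices $(A_n)_{n\ge1}$ is weakly (forward) sequentially primitive if there is an almost surely finite stopping time $\tau$ such that each row of $M_\tau=A_\tau\cdots A_1$ is either strictly positive or zero. A process $(\xi_n)$ (possibly taking the value $\infty$) is weakly subexponential if for any $\varepsilon>0$, almost surely, for all $n$ with finitely many exceptions, $|\xi_n|\le e^{\varepsilon n}$ or $\xi_n=\infty$. For ratios of entries, $a/0=\infty$ for $a>0$, and indices $n$ with $0/0$ are disregarded. Lyapunov exponents: for a realization of the sequence and $x\in\mathbb R^p$ put $\lambda(x)=\limsup_n\frac1n\log|A_n\cdots A_1x|$ and $L_\mu=\{x:\lambda(x)\le\mu\}$, a linear subspace. There are finitely many values $\mu_1>\dots>\mu_q\ge-\infty$ with $\mathbb R^p=L_{\mu_1}\supsetneq\dots\supsetneq L_{\mu_q}\supsetneq\{0\}=:L_{\mu_{q+1}}$, $\lambda(x)=\mu_r$ on $L_{\mu_r}\setminus L_{\mu_{r+1}}$. The full spectrum $\lambda_1\ge\lambda_2\ge\dots\ge\lambda_p\ge-\infty$ lists each $\mu_r$ with multiplicity $\dim L_{\mu_r}-\dim L_{\mu_{r+1}}$. Under stationarity, ergodicity and $\mathbb E\log^+\|A_1\|<\infty$, the exponents are almost surely deterministic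 (Oseledec). Definition of $v^1$: write a singular value decomposition $M_n=U_n\Sigma_nV_n$ with $U_n,V_n$ orthogonal and $\Sigma_n$ diagonal with entries $\sigma_n^1\ge\dots\ge\sigma_n^p\ge0$; $v_n^1$ is the first row of $V_n$, with sign chosen so that $v_n^1\ge0$. When $\lambda_1>\lambda_2$, $v_n^1$ converges almost surely (a known lemma of Raghunathan), and $v^1=\lim_nv_n^1$. *)

theory Defs
  imports "HOL-Probability.Probability"
begin

text \<open>Processes are indexed by \<open>n \<ge> 1\<close>; the value at index \<open>0\<close> is never used.
  The law of a process is the distribution of \<open>(X 1, X 2, \<dots>)\<close> on sequence space.\<close>

definition process_law :: "'a measure \<Rightarrow> (nat \<Rightarrow> 'a \<Rightarrow> 'b::topological_space) \<Rightarrow> (nat \<Rightarrow> 'b) measure" where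
  "process_law P X = distr P (\<Pi>\<^sub>M n\<in>UNIV. borel) (\<lambda>\<omega> n. X (Suc n) \<omega>)"

definition strictly_stationary :: "'a measure \<Rightarrow> (nat \<Rightarrow> 'a \<Rightarrow> 'b::topological_space) \<Rightarrow> bool" where
  "strictly_stationary P X \<longleftrightarrow> (\<forall>k. process_law P (\<lambda>n. X (n + k)) = process_law P X)"

definition ergodic_process :: "'a measure \<Rightarrow> (nat \<Rightarrow> 'a \<Rightarrow> 'b::topological_space) \<Rightarrow> bool" where
  "ergodic_process P X \<longleftrightarrow>
     (\<forall>B \<in> sets (\<Pi>\<^sub>M n\<in>UNIV. borel). (\<lambda>s n. s (Suc n)) -` B = B \<longrightarrow>
        measure (process_law P X) B \<in> {0, 1})"

text \<open>\<open>mat_prod a n = a n ** \<dots> ** a 1\<close>.\<close>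

primrec mat_prod :: "(nat \<Rightarrow> real^'p^'p) \<Rightarrow> nat \<Rightarrow> real^'p^'p" where
  "mat_prod a 0 = mat 1"
| "mat_prod a (Suc n) = a (Suc n) ** mat_prod a n"

definition nonneg_matrix :: "real^'p^'p \<Rightarrow> bool" where
  "nonneg_matrix B \<longleftrightarrow> (\<forall>i j. 0 \<le> B $ i $ j)"

definition column_allowable :: "real^'p^'p \<Rightarrow> bool" where
  "column_allowable B \<longleftrightarrow> (\<forall>j. \<exists>i. 0 < B $ i $ j)"

text \<open>The time index of the natural filtration ranges over \<open>enat\<close>, so that stopping times
  may take the value \<open>\<infinity>\<close>.\<close>

definition natural_filtration ::
    "'a measure \<Rightarrow> (nat \<Rightarrow> 'a \<Rightarrow> 'b::topological_space) \<Rightarrow> enat \<Rightarrow> 'a measure" where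
  "natural_filtration P X t =
     sigma (space P) {X k -` B \<inter> space P | k B. 1 \<le> k \<and> enat k \<le> t \<and> B \<in> sets borel}"

definition weakly_sequentially_primitive :: "'a measure \<Rightarrow> (nat \<Rightarrow> 'a \<Rightarrow> real^'p^'p) \<Rightarrow> bool" where
  "weakly_sequentially_primitive P A \<longleftrightarrow>
     (\<exists>\<tau> :: 'a \<Rightarrow> enat. stopping_time (natural_filtration P A) \<tau> \<and>
        (AE \<omega> in P. 1 \<le> \<tau> \<omega> \<and> \<tau> \<omega> < \<infinity> \<and>
           (\<forall>i. (\<forall>k. 0 < mat_prod (\<lambda>n. A n \<omega>) (the_enat (\<tau> \<omega>)) $ i $ k)
              \<or> (\<forall>k. mat_prod (\<lambda>n. A n \<omega>) (the_enat (\<tau> \<omega>)) $ i $ k = 0))))"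

definition weakly_subexponential :: "'a measure \<Rightarrow> (nat \<Rightarrow> 'a \<Rightarrow> ereal) \<Rightarrow> bool" where
  "weakly_subexponential P \<xi> \<longleftrightarrow>
     (\<forall>\<epsilon>>0. AE \<omega> in P. \<forall>\<^sub>F n in sequentially.
        \<bar>\<xi> n \<omega>\<bar> \<le> ereal (exp (\<epsilon> * real n)) \<or> \<xi> n \<omega> = \<infinity>)"

text \<open>On \<open>ereal\<close>, \<open>a / 0 = \<infinity>\<close> for \<open>a > 0\<close>, whereas \<open>0 / 0 = 0\<close>; the latter value satisfies
  every bound \<open>\<le> exp (\<epsilon> n)\<close>, so indices with \<open>0 / 0\<close> are indeed disregarded by
  \<open>weakly_subexponential\<close>.\<close>

definition entry_ratio :: "(nat \<Rightarrow> 'a \<Rightarrow> real^'p^'p) \<Rightarrow> 'p \<Rightarrow> 'p \<Rightarrow> 'p \<Rightarrow> nat \<Rightarrow> 'a \<Rightarrow> ereal" where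
  "entry_ratio A i j k n \<omega> =
     ereal (mat_prod (\<lambda>m. A m \<omega>) n $ i $ k) / ereal (mat_prod (\<lambda>m. A m \<omega>) n $ j $ k)"

text \<open>Logarithm with \<open>log 0 = -\<infinity>\<close>; only used on nonnegative arguments.\<close>

definition elog :: "real \<Rightarrow> ereal" where
  "elog x = (if x \<le> 0 then -\<infinity> else ereal (ln x))"

definition lyap :: "(nat \<Rightarrow> real^'p^'p) \<Rightarrow> real^'p \<Rightarrow> ereal" where
  "lyap a x = limsup (\<lambda>n. elog (norm (mat_prod a n *v x)) / ereal (real n))"

definition lyap_space :: "(nat \<Rightarrow> real^'p^'p) \<Rightarrow> ereal \<Rightarrow> (real^'p) set" where
  "lyap_space a \<mu> = {x. lyap a x \<le> \<mu>}"

text \<open>The distinct values \<open>\<mu>\<^sub>1 > \<dots> > \<mu>\<^sub>q\<close>, as a list (so \<open>\<mu>\<^sub>r\<close> has position \<open>r - 1\<close>); the set of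
  values on nonzero vectors is finite, since the sublevel sets of \<open>lyap a\<close> form a chain of
  subspaces.\<close>

definition lyap_values :: "(nat \<Rightarrow> real^'p^'p) \<Rightarrow> ereal list" where
  "lyap_values a = rev (sorted_list_of_set (lyap a ` (UNIV - {0})))"

definition lyap_flag :: "(nat \<Rightarrow> real^'p^'p) \<Rightarrow> nat \<Rightarrow> (real^'p) set" where
  "lyap_flag a r =
     (if r < length (lyap_values a) then lyap_space a (lyap_values a ! r) else {0})"

definition lyap_spectrum :: "(nat \<Rightarrow> real^'p^'p) \<Rightarrow> ereal list" where
  "lyap_spectrum a =
     concat (map (\<lambda>r. replicate (dim (lyap_flag a r) - dim (lyap_flag a (Suc r))) (lyap_values a ! r))
       [0..<length (lyap_values a)])"

text \<open>\<open>lyapunov_exponent a k\<close> is \<open>\<lambda>\<^sub>k\<close>, for \<open>1 \<le> k \<le> p\<close>.\<close>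

definition lyapunov_exponent :: "(nat \<Rightarrow> real^'p^'p) \<Rightarrow> nat \<Rightarrow> ereal" where
  "lyapunov_exponent a k = lyap_spectrum a ! (k - 1)"

text \<open>The linear order on the index type only serves to list the singular values decreasingly;
  the first row is the one indexed by the least element.\<close>

definition is_svd ::
    "real^('p::{finite,linorder})^('p::{finite,linorder}) \<Rightarrow>
     real^('p::{finite,linorder})^('p::{finite,linorder}) \<Rightarrow>
     real^('p::{finite,linorder})^('p::{finite,linorder}) \<Rightarrow>
     real^('p::{finite,linorder})^('p::{finite,linorder}) \<Rightarrow> bool" where
  "is_svd B U S V \<longleftrightarrow>
     orthogonal_matrix U \<and> orthogonal_matrix V \<and>
     (\<forall>i j. i \<noteq> j \<longrightarrow> S $ i $ j = 0) \<and> (\<forall>i. 0 \<le> S $ i $ i) \<and>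
     (\<forall>i j. i \<le> j \<longrightarrow> S $ j $ j \<le> S $ i $ i) \<and>
     B = U ** S ** V"

text \<open>Negating the first row of \<open>V\<close> and the first column of \<open>U\<close> yields another singular value
  decomposition, so the choice of sign is part of the choice of \<open>V\<close>.\<close>

definition leading_right_singular_vector ::
    "real^('p::{finite,linorder})^('p::{finite,linorder}) \<Rightarrow> real^('p::{finite,linorder}) \<Rightarrow> bool" where
  "leading_right_singular_vector B v \<longleftrightarrow>
     (\<exists>U S V. is_svd B U S V \<and> v = row (Min UNIV) V) \<and> (\<forall>i. 0 \<le> v $ i)"

definition nonneg_vectors :: "(real^'p) set" where
  "nonneg_vectors = {x. (\<forall>i. 0 \<le> x $ i) \<and> x \<noteq> 0}"

end

theory Submission
  imports Defs
begin

text \<open>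
  For \<open>y = (v\<^sup>1 w) x - (v\<^sup>1 x) w\<close> one has
  \<open>e\<^sub>i\<^sup>\<top> M\<^sub>n x / e\<^sub>i\<^sup>\<top> M\<^sub>n w - v\<^sup>1 x / v\<^sup>1 w = e\<^sub>i\<^sup>\<top> M\<^sub>n y / ((e\<^sub>i\<^sup>\<top> M\<^sub>n w) (v\<^sup>1 w))\<close>.
  By sequential primitivity and subexponentiality all nonzero rows of \<open>M\<^sub>n\<close> have size
  \<open>exp (n \<lambda>\<^sub>1 + o(n))\<close>, so the largest error decays at the exact rate \<open>\<lambda>(y) - \<lambda>\<^sub>1\<close>. The limit
  \<open>v\<^sup>1\<close> is the nonnegative unit normal of the hyperplane \<open>{\<lambda> < \<lambda>\<^sub>1}\<close>: on that hyperplane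
  \<open>|M\<^sub>n y|\<close> is negligible against the norm of \<open>M\<^sub>n\<close>. Hence \<open>y\<close> always lies in the hyperplane, and outside
  a null set of pairs \<open>(x, w)\<close> it avoids the proper subspace \<open>{\<lambda> < \<lambda>\<^sub>2}\<close>. That the growth rate of
  \<open>M\<^sub>n\<close> is a limit and not only a limes superior is the Furstenberg-Kesten theorem, obtained here
  from Kingman's subadditive theorem.
\<close>

section \<open>Subadditive processes\<close>

text \<open>The exceptional null set of pairs has to be chosen before \<omega>, while the subspace
  {\<lambda> < \<lambda>_2} to be avoided depends on \<omega>. Hence Fubini: for almost every
  \<omega> the bad pairs are Lebesgue null, and exchanging the quantifiers requires a condition that
  is jointly measurable in \<omega> and the pair. A limes superior for the growth of M_n would not
  do: the error is comparable to |M_n y| / |M_n|, and bounding it from above needs |M_n| from below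
  at every large n. Subexponentiality says nothing about a ratio with zero denominator. Primitivity
  removes this case: from some time on a nonzero row is strictly positive, so each of its entries is
  a usable denominator, and comparing column by column shows that such a row carries at least the
  fraction exp(-\<epsilon> n) / p of the total entry sum. The exponent \<lambda>_2 may be
  -\<infinity>, whereas \<lambda>_1 is finite: the gap excludes -\<infinity> and the log moment
  excludes \<infinity>.\<close>

locale measure_preserving = prob_space \<nu> for \<nu> :: "'s measure" +
  fixes T :: "'s \<Rightarrow> 's"
  assumes T_measurable [measurable]: "T \<in> measurable \<nu> \<nu>"
    and T_preserves: "distr \<nu> \<nu> T = \<nu>"
begin

lemma funpow_measurable [measurable]: "(T ^^ k) \<in> measurable \<nu> \<nu>"
  by (induction k) (auto simp: id_def intro: measurable_comp)

lemma distr_funpow: "distr \<nu> \<nu> (T ^^ k) = \<nu>"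
proof (induction k)
  case (Suc k)
  have "distr \<nu> \<nu> (T ^^ Suc k) = distr (distr \<nu> \<nu> (T ^^ k)) \<nu> T"
    by (simp add: distr_distr)
  then show ?case using Suc T_preserves by (simp add: o_def)
qed (simp add: id_def distr_id)

lemma AE_funpow: "AE x in \<nu>. Q x \<Longrightarrow> AE x in \<nu>. \<forall>k. Q ((T ^^ k) x)"
proof -
  assume Q: "AE x in \<nu>. Q x"
  have "AE x in \<nu>. Q ((T ^^ k) x)" for k
  proof -
    have "AE x in distr \<nu> \<nu> (T ^^ k). Q x" unfolding distr_funpow by (rule Q)
    then show ?thesis by (rule AE_distrD[OF funpow_measurable])
  qed
  then show ?thesis by (simp add: AE_all_countable)
qed

lemma integral_T:
  fixes f :: "'s \<Rightarrow> real"
  assumes "integrable \<nu> f"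
  shows "(\<integral>x. f (T x) \<partial>\<nu>) = (\<integral>x. f x \<partial>\<nu>)" "integrable \<nu> (\<lambda>x. f (T x))"
proof -
  have [measurable]: "f \<in> borel_measurable \<nu>" using assms by simp
  show "(\<integral>x. f (T x) \<partial>\<nu>) = (\<integral>x. f x \<partial>\<nu>)"
    using integral_distr[OF T_measurable, of f] T_preserves by simp
  show "integrable \<nu> (\<lambda>x. f (T x))"
    using integrable_distr_eq[OF T_measurable, of f] T_preserves assms by simp
qed

lemma integrable_funpow:
  fixes f :: "'s \<Rightarrow> real"
  assumes "integrable \<nu> f"
  shows "integrable \<nu> (\<lambda>x. f ((T ^^ k) x))"
  using assms
proof (induction k arbitrary: f)
  case (Suc k)
  show ?case using Suc.IH[OF integral_T(2)[OF Suc.prems]] by simp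
qed simp

text \<open>Garsia's argument: where \<open>F > 0\<close>, the maximum is attained at a nonempty sum, whence \<open>F \<le> f + F \<circ> T\<close>.\<close>

lemma maximal_ergodic:
  fixes f :: "'s \<Rightarrow> real" and n :: nat
  assumes f: "integrable \<nu> f"
  defines "F \<equiv> \<lambda>x. Max ((\<lambda>m. \<Sum>k<m. f ((T ^^ k) x)) ` {..n})"
  shows "0 \<le> (\<integral>x. indicator {x. 0 < F x} x * f x \<partial>\<nu>)"
proof -
  have [measurable]: "f \<in> borel_measurable \<nu>" using f by simp
  have Fm [measurable]: "F \<in> borel_measurable \<nu>" 
    unfolding F_def by (intro borel_measurable_Max) auto
  have int: "integrable \<nu> F"
  proof (rule Bochner_Integration.integrable_bound[where f="\<lambda>x. \<Sum>k<n. \<bar>f ((T ^^ k) x)\<bar>"])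
    show "integrable \<nu> (\<lambda>x. \<Sum>k<n. \<bar>f ((T ^^ k) x)\<bar>)"
      by (intro Bochner_Integration.integrable_sum integrable_abs integrable_funpow f)
    show "AE x in \<nu>. norm (F x) \<le> norm (\<Sum>k<n. \<bar>f ((T ^^ k) x)\<bar>)"
    proof (rule AE_I2)
      fix x
      have "F x \<in> (\<lambda>m. \<Sum>k<m. f ((T ^^ k) x)) ` {..n}"
        unfolding F_def by (rule Max_in) auto
      then obtain m where m: "m \<le> n" "F x = (\<Sum>k<m. f ((T ^^ k) x))" by auto
      have "\<bar>F x\<bar> \<le> (\<Sum>k<m. \<bar>f ((T ^^ k) x)\<bar>)" unfolding m(2) by (rule sum_abs)
      also have "\<dots> \<le> (\<Sum>k<n. \<bar>f ((T ^^ k) x)\<bar>)" using m(1) by (intro sum_mono2) auto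
      finally show "norm (F x) \<le> norm (\<Sum>k<n. \<bar>f ((T ^^ k) x)\<bar>)" by simp
    qed
  qed simp
  have F0: "0 \<le> F x" for x
  proof -
    have "(\<Sum>k<0. f ((T ^^ k) x)) \<le> F x"
      unfolding F_def by (rule Max_ge) (auto intro!: image_eqI[of _ _ 0])
    then show ?thesis by simp
  qed
  have key: "F x - F (T x) \<le> indicator {x. 0 < F x} x * f x" for x
  proof (cases "0 < F x")
    case True
    have "F x \<in> (\<lambda>m. \<Sum>k<m. f ((T ^^ k) x)) ` {..n}"
      unfolding F_def by (rule Max_in) auto
    then obtain m where m: "m \<le> n" "F x = (\<Sum>k<m. f ((T ^^ k) x))" by auto
    with True obtain m' where m': "m = Suc m'" by (cases m) auto
    have "F x = f x + (\<Sum>k<m'. f ((T ^^ k) (T x)))"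
      unfolding m(2) m' by (simp only: sum.lessThan_Suc_shift funpow_Suc_right o_def) simp
    moreover have "(\<Sum>k<m'. f ((T ^^ k) (T x))) \<le> F (T x)"
      unfolding F_def using m(1) m' by (intro Max_ge) auto
    ultimately show ?thesis using True by simp
  next
    case False
    then show ?thesis using F0[of x] F0[of "T x"] by simp
  qed
  have "0 = (\<integral>x. F x - F (T x) \<partial>\<nu>)"
    using integral_T[OF int] int by simp
  also have "\<dots> \<le> (\<integral>x. indicator {x. 0 < F x} x * f x \<partial>\<nu>)"
  proof (rule integral_mono)
    show "integrable \<nu> (\<lambda>x. F x - F (T x))" using integral_T(2)[OF int] int by simp
    have "integrable \<nu> (\<lambda>x. indicator {x \<in> space \<nu>. 0 < F x} x * f x)"
      by (rule integrable_real_mult_indicator[OF _ f, unfolded mult.commute[of "f _"]]) measurable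
    then show "integrable \<nu> (\<lambda>x. indicator {x. 0 < F x} x * f x)"
      by (rule Bochner_Integration.integrable_cong[THEN iffD1, rotated -1]) (auto simp: indicator_def)
  qed (rule key)
  finally show ?thesis .
qed

text \<open>The maximal ergodic inequality for \<open>h - a\<close>. The empty sum is among the
  candidates, so {F > 0} is exactly the event in question; off it \<open>h\<close> is nonnegative,
  so the integral of \<open>h\<close> is at least \<open>a\<close> times the measure of the
  event.\<close>

lemma maximal_inequality_upto:
  fixes h :: "'s \<Rightarrow> real" and n :: nat
  assumes h: "integrable \<nu> h" and h0: "\<And>x. 0 \<le> h x" and a: "a > 0"
  shows "measure \<nu> {x \<in> space \<nu>. \<exists>m\<le>n. a * real m < (\<Sum>k<m. h ((T ^^ k) x))} \<le> (\<integral>x. h x \<partial>\<nu>) / a"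
proof -
  let ?f = "\<lambda>x. h x - a"
  define F where "F = (\<lambda>x. Max ((\<lambda>m. \<Sum>k<m. ?f ((T ^^ k) x)) ` {..n}))"
  define E where "E = {x \<in> space \<nu>. \<exists>m\<le>n. a * real m < (\<Sum>k<m. h ((T ^^ k) x))}"
  have [measurable]: "h \<in> borel_measurable \<nu>" using h by simp
  have E [measurable]: "E \<in> sets \<nu>" unfolding E_def by measurable
  have eq: "x \<in> E \<longleftrightarrow> 0 < F x" if "x \<in> space \<nu>" for x
    using that unfolding E_def F_def by (subst Max_gr_iff) (auto simp: sum_subtractf mult.commute)
  have "0 \<le> (\<integral>x. indicator {x. 0 < F x} x * ?f x \<partial>\<nu>)"
    unfolding F_def by (rule maximal_ergodic) (use h in simp)
  also have "\<dots> = (\<integral>x. indicator E x * ?f x \<partial>\<nu>)"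
    by (intro Bochner_Integration.integral_cong) (auto simp: indicator_def eq)
  also have "\<dots> \<le> (\<integral>x. h x - a * indicator E x \<partial>\<nu>)"
  proof (rule integral_mono)
    show "integrable \<nu> (\<lambda>x. indicator E x * ?f x)"
      using integrable_real_mult_indicator[OF E, of ?f] h by (simp add: mult.commute)
    show "integrable \<nu> (\<lambda>x. h x - a * indicator E x)"
      using h by (auto intro!: Bochner_Integration.integrable_diff integrable_mult_right integrable_real_indicator
          simp: emeasure_eq_measure)
  qed (auto simp: indicator_def h0)
  also have "\<dots> = (\<integral>x. h x \<partial>\<nu>) - a * measure \<nu> E"
    using h by (subst Bochner_Integration.integral_diff) (auto intro!: integrable_mult_right integrable_real_indicator
          simp: emeasure_eq_measure)
  finally show ?thesis using a unfolding E_def by (simp add: field_simps)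
qed

lemma maximal_inequality:
  fixes h :: "'s \<Rightarrow> real"
  assumes h: "integrable \<nu> h" and h0: "\<And>x. 0 \<le> h x" and a: "a > 0"
  shows "measure \<nu> {x \<in> space \<nu>. \<exists>m. a * real m < (\<Sum>k<m. h ((T ^^ k) x))} \<le> (\<integral>x. h x \<partial>\<nu>) / a"
proof -
  have [measurable]: "h \<in> borel_measurable \<nu>" using h by simp
  let ?E = "\<lambda>n. {x \<in> space \<nu>. \<exists>m\<le>n. a * real m < (\<Sum>k<m. h ((T ^^ k) x))}"
  have "(\<lambda>n. measure \<nu> (?E n)) \<longlonglongrightarrow> measure \<nu> (\<Union>n. ?E n)"
    by (rule finite_Lim_measure_incseq) (auto simp: incseq_def intro: order_trans)
  moreover have "(\<Union>n. ?E n) = {x \<in> space \<nu>. \<exists>m. a * real m < (\<Sum>k<m. h ((T ^^ k) x))}"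
    by auto
  ultimately show ?thesis
    using LIMSEQ_le_const2[of _ _ "(\<integral>x. h x \<partial>\<nu>) / a"] maximal_inequality_upto[OF h h0 a] by fastforce
qed

text \<open>Stands in for Birkhoff's theorem: the bound is uniform in m and asks for no limit of the
  averages. If no N works for a given a, the point lies in the maximal event of every
  \<open>h N\<close>, whose measure is at most the integral of \<open>h N\<close> divided by a and
  so tends to 0.\<close>

lemma AE_small_averages:
  fixes h :: "nat \<Rightarrow> 's \<Rightarrow> real"
  assumes h: "\<And>N. integrable \<nu> (h N)" and h0: "\<And>N x. 0 \<le> h N x"
    and lim: "(\<lambda>N. \<integral>x. h N x \<partial>\<nu>) \<longlonglongrightarrow> 0"
  shows "AE x in \<nu>. \<forall>a>0. \<exists>N. \<forall>m. (\<Sum>k<m. h N ((T ^^ k) x)) \<le> a * real m"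
proof -
  have [measurable]: "h N \<in> borel_measurable \<nu>" for N using h by simp
  have *: "AE x in \<nu>. \<exists>N. \<forall>m. (\<Sum>k<m. h N ((T ^^ k) x)) \<le> a * real m" if a: "a > 0" for a
  proof -
    let ?E = "{x \<in> space \<nu>. \<forall>N. \<exists>m. a * real m < (\<Sum>k<m. h N ((T ^^ k) x))}"
    have "measure \<nu> ?E \<le> (\<integral>x. h N x \<partial>\<nu>) / a" for N
    proof -
      have "measure \<nu> ?E \<le> measure \<nu> {x \<in> space \<nu>. \<exists>m. a * real m < (\<Sum>k<m. h N ((T ^^ k) x))}"
        by (rule finite_measure_mono) auto
      also have "\<dots> \<le> (\<integral>x. h N x \<partial>\<nu>) / a" by (rule maximal_inequality[OF h h0 a])
      finally show ?thesis .
    qed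
    moreover have "(\<lambda>N. (\<integral>x. h N x \<partial>\<nu>) / a) \<longlonglongrightarrow> 0 / a" by (intro tendsto_divide lim) (use a in auto)
    ultimately have "measure \<nu> ?E \<le> 0" using LIMSEQ_le_const[of _ "0 / a" "measure \<nu> ?E"] by auto
    then have "measure \<nu> ?E = 0" using measure_nonneg[of \<nu> ?E] by linarith
    then have "?E \<in> null_sets \<nu>" by (auto simp: emeasure_eq_measure)
    then show ?thesis by (rule AE_I') (auto simp: not_le)
  qed
  have "AE x in \<nu>. \<forall>j. \<exists>N. \<forall>m. (\<Sum>k<m. h N ((T ^^ k) x)) \<le> inverse (real (Suc j)) * real m"
    unfolding AE_all_countable by (intro allI *) simp
  then show ?thesis
  proof eventually_elim
    case (elim x)
    show ?case
    proof (intro allI impI)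
      fix a :: real assume "a > 0"
      then obtain j where j: "inverse (real (Suc j)) < a" using reals_Archimedean by blast
      from elim obtain N where N: "\<And>m. (\<Sum>k<m. h N ((T ^^ k) x)) \<le> inverse (real (Suc j)) * real m" by blast
      have "(\<Sum>k<m. h N ((T ^^ k) x)) \<le> a * real m" for m
        using N[of m] mult_right_mono[OF less_imp_le[OF j], of "real m"] by linarith
      then show "\<exists>N. \<forall>m. (\<Sum>k<m. h N ((T ^^ k) x)) \<le> a * real m" by blast
    qed
  qed
qed

end

text \<open>Greedy covering of \<open>[k, k + n)\<close>: each point starts either a block of length at most \<open>N\<close> with
  average at most \<open>c\<close>, or a block of length one with excess \<open>H\<close>. The \<open>F\<close>-sum pays for the last
  incomplete block.\<close>

lemma subadditive_covering:
  fixes G :: "nat \<Rightarrow> nat \<Rightarrow> real" and F H :: "nat \<Rightarrow> real" and c :: real and N :: nat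
  assumes sub: "\<And>k l m. 1 \<le> l \<Longrightarrow> 1 \<le> m \<Longrightarrow> G k (l + m) \<le> G k l + G (k + l) m"
    and F0: "\<And>j. 0 \<le> F j" and H0: "\<And>j. 0 \<le> H j"
    and F: "\<And>j. G j 1 \<le> c + F j"
    and cover: "\<And>j. G j 1 \<le> c + H j \<or> (\<exists>l\<in>{1..N}. G j l \<le> c * real l)"
    and N: "1 \<le> N" and n: "1 \<le> n"
  shows "G k n \<le> c * real n + (\<Sum>j=k..<k+n. H j) + (\<Sum>j=k+n-N..<k+n. F j)"
  using n
proof (induction n arbitrary: k rule: less_induct)
  case (less n)
  show ?case
  proof (cases "n \<le> N")
    case True
    have "G k n \<le> c * real n + (\<Sum>j=k..<k+n. F j)" if "1 \<le> n" for n
      using that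
    proof (induction n rule: dec_induct)
      case base
      then show ?case using F[of k] by simp
    next
      case (step n)
      then show ?case using sub[of n 1 k] F[of "k+n"] by (simp add: algebra_simps)
    qed
    from this[OF less.prems] have "G k n \<le> c * real n + (\<Sum>j=k..<k+n. F j)" .
    \<comment> \<open>For n \<le> N the final window contains the whole interval, also when the
      natural subtraction is cut off at 0, so steps of length one paid by F are enough.\<close>
    moreover have "(\<Sum>j=k..<k+n. F j) \<le> (\<Sum>j=k+n-N..<k+n. F j)"
      using True by (intro sum_mono2) (auto simp: F0)
    moreover have "0 \<le> (\<Sum>j=k..<k+n. H j)" by (intro sum_nonneg) (auto simp: H0)
    ultimately show ?thesis by linarith
  next
    case False
    \<comment> \<open>The first block has length at most N < n, so a nonempty rest remains;
      subadditivity is available only for two nonempty pieces.\<close>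
    obtain l where l: "1 \<le> l" "l < n" "G k l \<le> c * real l + (\<Sum>j=k..<k+l. H j)"
    proof (cases "G k 1 \<le> c + H k")
      case True
      then show ?thesis using that[of 1] False N by simp
    next
      case F2: False
      then obtain l where "l \<in> {1..N}" "G k l \<le> c * real l" using cover[of k] by auto
      moreover have "0 \<le> (\<Sum>j=k..<k+l. H j)" by (intro sum_nonneg) (auto simp: H0)
      ultimately show ?thesis using that[of l] False by auto
    qed
    have "G k n \<le> G k l + G (k + l) (n - l)"
      using sub[of l "n - l" k] l by simp
    moreover have "G (k + l) (n - l) \<le> c * real (n - l) + (\<Sum>j=k+l..<k+n. H j) + (\<Sum>j=k+n-N..<k+n. F j)"
      using less.IH[of "n - l" "k + l"] l by simp
    moreover have "(\<Sum>j=k..<k+n. H j) = (\<Sum>j=k..<k+l. H j) + (\<Sum>j=k+l..<k+n. H j)"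
      using l by (intro sum.atLeastLessThan_concat[symmetric]) auto
    moreover have "c * real n = c * real l + c * real (n - l)" using l by (simp add: of_nat_diff algebra_simps)
    ultimately show ?thesis using l by linarith
  qed
qed

section \<open>Kingman's theorem: existence of the limit of g n / n along almost every orbit\<close>

locale subadditive_cocycle = measure_preserving +
  fixes g :: "nat \<Rightarrow> 'a \<Rightarrow> real"
  assumes g_measurable [measurable]: "\<And>n. g n \<in> borel_measurable \<nu>"
    and g_subadditive: "AE x in \<nu>. \<forall>l\<ge>1. \<forall>m\<ge>1. g (l + m) x \<le> g l x + g m ((T ^^ l) x)"
    and g_integrable: "integrable \<nu> (\<lambda>x. max 0 (g 1 x))"
begin

lemma AE_subadditive:
  "AE x in \<nu>. \<forall>k. \<forall>l\<ge>1. \<forall>m\<ge>1. g (l + m) ((T ^^ k) x) \<le> g l ((T ^^ k) x) + g m ((T ^^ (k + l)) x)"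
  using AE_funpow[OF g_subadditive]
proof eventually_elim
  case (elim x)
  have "(T ^^ l) ((T ^^ k) x) = (T ^^ (k + l)) x" for k l
    by (simp add: add.commute[of k l] funpow_add)
  with elim show ?case by simp
qed

text \<open>The functions max 0 (g 1) / (N + 1) have integrals tending to 0, so
  \<open>AE_small_averages\<close> with a = 1 bounds the orbit sums of max 0 (g 1) by (N + 1) m; the
  random N + 1 is the slope C. This keeps the limes superior below \<infinity>.\<close>

lemma AE_linear_bound: "AE x in \<nu>. \<exists>C. \<forall>n\<ge>1. g n x \<le> C * real n"
proof -
  let ?f = "\<lambda>x. max 0 (g 1 x)"
  have lim: "(\<lambda>N. \<integral>x. ?f x / real (Suc N) \<partial>\<nu>) \<longlonglongrightarrow> 0"
    using LIMSEQ_Suc[OF lim_const_over_n[of "\<integral>x. ?f x \<partial>\<nu>"]] by simp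
  have "AE x in \<nu>. \<forall>a>0. \<exists>N. \<forall>m. (\<Sum>k<m. ?f ((T ^^ k) x) / real (Suc N)) \<le> a * real m"
    by (rule AE_small_averages[OF _ _ lim]) (use g_integrable in auto)
  with AE_subadditive show ?thesis
  proof eventually_elim
    case (elim x)
    from elim(2)[rule_format, of 1] obtain N
      where N: "\<And>m. (\<Sum>k<m. ?f ((T ^^ k) x) / real (Suc N)) \<le> real m" by auto
    have "g n x \<le> (\<Sum>k<n. ?f ((T ^^ k) x))" if "n \<ge> 1" for n
      using that
    proof (induction n rule: dec_induct)
      case (step n)
      have "g (n + 1) x \<le> g n x + g 1 ((T ^^ n) x)"
        using elim(1)[rule_format, of n 1 0] step by simp
      then show ?case using step by simp
    qed simp
    moreover have "(\<Sum>k<n. ?f ((T ^^ k) x)) \<le> real (Suc N) * real n" for n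
      using N[of n] by (simp add: sum_divide_distrib[symmetric] field_simps)
    ultimately show ?case by (intro exI[of _ "real (Suc N)"]) (auto intro: order_trans)
  qed
qed

text \<open>Lies between {liminf g n / n < c} and {liminf g n / n \<le> c}. The slack K absorbs the
  change caused by prepending one step to the orbit, which makes the set invariant; taking K natural
  keeps the quantifiers countable.\<close>

definition low :: "real \<Rightarrow> 'a set" where
  "low c = {x \<in> space \<nu>. \<exists>K::nat. \<forall>n0. \<exists>n\<ge>n0. g n x \<le> c * real n + real K}"

lemma low_measurable [measurable]: "low c \<in> sets \<nu>"
  unfolding low_def by measurable

text \<open>Subadditivity only gives the backward direction: T x in \<open>low c\<close> implies x
  in \<open>low c\<close>. Since T preserves the measure, the preimage of \<open>low c\<close> is a
  subset of equal measure, so the two differ by a null set and the forward direction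
  follows.\<close>

lemma AE_low_invariant: "AE x in \<nu>. x \<in> low c \<longrightarrow> (\<forall>k. (T ^^ k) x \<in> low c)"
proof -
  have "AE x in \<nu>. T x \<in> low c \<longrightarrow> x \<in> low c"
    using g_subadditive AE_space
  proof eventually_elim
    case (elim x)
    show ?case
    proof
      assume "T x \<in> low c"
      then obtain K :: nat where K: "\<And>n0. \<exists>n\<ge>n0. g n (T x) \<le> c * real n + real K" by (auto simp: low_def)
      obtain K' :: nat where K': "real K + \<bar>g 1 x\<bar> + \<bar>c\<bar> \<le> real K'" using real_arch_simple by blast
      have "\<exists>n\<ge>n0. g n x \<le> c * real n + real K'" for n0
      proof -
        obtain n where n: "n \<ge> max 1 n0" "g n (T x) \<le> c * real n + real K" using K by blast
        have "g (1 + n) x \<le> g 1 x + g n (T x)" using elim(1)[rule_format, of 1 n] n(1) by simp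
        then have "g (1 + n) x \<le> c * real (1 + n) + real K'" using n(2) K' by (simp add: algebra_simps)
        then show ?thesis using n(1) by (intro exI[of _ "1 + n"]) auto
      qed
      then show "x \<in> low c" using elim(2) by (auto simp: low_def)
    qed
  qed
  moreover have "AE x in \<nu>. \<not> (x \<in> low c \<and> T x \<notin> low c)"
  proof -
    let ?D = "low c" and ?D' = "T -` low c \<inter> space \<nu>"
    have D' [measurable]: "?D' \<in> sets \<nu>" by measurable
    have "measure \<nu> ?D' = measure \<nu> ?D"
      using measure_distr[OF T_measurable low_measurable] T_preserves by simp
    moreover have "measure \<nu> (?D \<inter> ?D') = measure \<nu> ?D'"
      using calculation \<open>AE x in \<nu>. T x \<in> low c \<longrightarrow> x \<in> low c\<close>
      by (intro finite_measure_eq_AE) auto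
    ultimately have "measure \<nu> (?D - (?D \<inter> ?D')) = 0"
      by (subst finite_measure_Diff) auto
    then have "?D - (?D \<inter> ?D') \<in> null_sets \<nu>" by (auto simp: emeasure_eq_measure)
    then show ?thesis by (rule AE_I') auto
  qed
  ultimately have "AE x in \<nu>. \<forall>k. (T ^^ k) x \<in> low c \<longrightarrow> T ((T ^^ k) x) \<in> low c"
    by (intro AE_funpow) auto
  then show ?thesis
  proof eventually_elim
    case (elim x)
    have "(T ^^ k) x \<in> low c" if "x \<in> low c" for k
      using that elim by (induction k) auto
    then show ?case by blast
  qed
qed

text \<open>Cover orbits by the blocks on which \<open>g\<close> has average at most \<open>c'\<close>. The points of \<open>low c\<close> without
  such a block of length at most \<open>N\<close> form the set \<open>B N\<close>, which shrinks to the empty set; the maximal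
  inequality makes their contribution \<open>h N\<close>, and the incomplete block at the end (through the
  truncation \<open>r\<close>), asymptotically small. The set \<open>low c\<close> is invariant, so the block condition persists along the orbit.\<close>

lemma AE_upper_le:
  assumes cc': "c < c'"
  shows "AE x in \<nu>. x \<in> low c \<longrightarrow> (\<forall>e>0. \<forall>\<^sub>F n in sequentially. g n x \<le> (c' + e) * real n)"
proof -
  \<comment> \<open>As c' + |c'| \<ge> 0, a block of length one costs at most c' + F, with F
    nonnegative and integrable.\<close>
  define F where "F = (\<lambda>x. max 0 (g 1 x) + \<bar>c'\<bar>)"
  define B where "B = (\<lambda>N. {x \<in> low c. \<forall>l\<in>{1..N}. g l x > c' * real l})"
  define h where "h = (\<lambda>N x. F x * indicator (B N) x)"
  define r where "r = (\<lambda>N x. max 0 (F x - real N))"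
  have F_int: "integrable \<nu> F" unfolding F_def using g_integrable by simp
  have F0: "0 \<le> F x" for x unfolding F_def by simp
  have [measurable]: "F \<in> borel_measurable \<nu>" unfolding F_def by measurable
  have B [measurable]: "B N \<in> sets \<nu>" for N unfolding B_def by measurable
  have h_int: "integrable \<nu> (h N)" for N
    unfolding h_def by (rule integrable_real_mult_indicator[OF B F_int])
  have h0: "0 \<le> h N x" for N x unfolding h_def using F0 by simp
  have hlim: "(\<lambda>N. \<integral>x. h N x \<partial>\<nu>) \<longlonglongrightarrow> (\<integral>x. 0 \<partial>\<nu>)"
  proof (rule integral_dominated_convergence[where w=F])
    show "AE x in \<nu>. (\<lambda>N. h N x) \<longlonglongrightarrow> 0"
    proof (rule AE_I2)
      fix x
      have "\<exists>N0. x \<notin> B N0"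
      proof (cases "x \<in> low c")
        case True
        \<comment> \<open>For infinitely many n one has g n x \<le> c n + K, and the difference c' -
          c swallows K once n is large; such an n is the length of a good block.\<close>
        then obtain K :: nat where K: "\<And>n0. \<exists>n\<ge>n0. g n x \<le> c * real n + real K" by (auto simp: low_def)
        obtain n0 :: nat where n0: "real K / (c' - c) \<le> real n0" using real_arch_simple by blast
        obtain n where n: "n \<ge> max 1 n0" "g n x \<le> c * real n + real K" using K by blast
        have "real K / (c' - c) \<le> real n" using n0 n(1) by linarith
        then have "real K \<le> (c' - c) * real n" using cc' by (simp add: field_simps)
        then have "g n x \<le> c' * real n" using n(2) by (simp add: algebra_simps)
        then show ?thesis using n(1) by (intro exI[of _ n]) (auto simp: B_def not_less intro!: bexI[of _ n])
      qed (auto simp: B_def)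
      then obtain N0 where "x \<notin> B N0" by blast
      then have "x \<notin> B N" if "N \<ge> N0" for N using that by (auto simp: B_def)
      then have "\<forall>\<^sub>F N in sequentially. h N x = 0"
        unfolding eventually_sequentially h_def by (intro exI[of _ N0]) auto
      then show "(\<lambda>N. h N x) \<longlonglongrightarrow> 0" by (rule tendsto_eventually)
    qed
  next
    show "AE x in \<nu>. norm (h N x) \<le> F x" for N
      by (rule AE_I2) (auto simp: h_def indicator_def F0)
  qed (auto simp: F_int h_def)
  have r_int: "integrable \<nu> (r N)" for N
    unfolding r_def by (intro integrable_max F_int Bochner_Integration.integrable_diff) auto
  have rlim: "(\<lambda>N. \<integral>x. r N x \<partial>\<nu>) \<longlonglongrightarrow> (\<integral>x. 0 \<partial>\<nu>)"
  proof (rule integral_dominated_convergence[where w=F])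
    show "AE x in \<nu>. (\<lambda>N. r N x) \<longlonglongrightarrow> 0"
    proof (rule AE_I2)
      fix x
      obtain N0 :: nat where "F x \<le> real N0" using real_arch_simple by blast
      then have "\<forall>\<^sub>F N in sequentially. r N x = 0"
        unfolding eventually_sequentially r_def by (intro exI[of _ N0]) auto
      then show "(\<lambda>N. r N x) \<longlonglongrightarrow> 0" by (rule tendsto_eventually)
    qed
  next
    show "AE x in \<nu>. norm (r N x) \<le> F x" for N
      using F0 by (intro AE_I2) (auto simp: r_def)
  qed (auto simp: F_int r_def)
  have "AE x in \<nu>. \<forall>a>0. \<exists>N. \<forall>m. (\<Sum>k<m. h N ((T ^^ k) x)) \<le> a * real m"
    by (rule AE_small_averages) (use h_int h0 hlim in auto)
  moreover have "AE x in \<nu>. \<forall>a>0. \<exists>N. \<forall>m. (\<Sum>k<m. r N ((T ^^ k) x)) \<le> a * real m"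
    by (rule AE_small_averages) (use r_int rlim in \<open>auto simp: r_def\<close>)
  moreover note AE_subadditive AE_low_invariant[of c]
  ultimately show ?thesis
  proof eventually_elim
    case (elim x)
    show ?case
    proof (intro impI allI)
      fix e :: real assume x: "x \<in> low c" and e: "e > 0"
      then have low: "(T ^^ k) x \<in> low c" for k using elim(4) by blast
      obtain N where N: "\<And>m. (\<Sum>k<m. h N ((T ^^ k) x)) \<le> e/3 * real m"
        using elim(1)[rule_format, of "e/3"] e by auto
      \<comment> \<open>The final window of the covering has at most N + 1 terms, each at most K + a
        n; with this a they add up to a constant plus (e/3) n. The other two thirds of e pay for the
        points of \<open>B N\<close> and for that constant.\<close>
      define a where "a = e / (3 * (real N + 1))"
      have a: "a > 0" using e by (simp add: a_def)
      obtain K where K: "\<And>m. (\<Sum>k<m. r K ((T ^^ k) x)) \<le> a * real m"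
        using elim(2)[rule_format, of a] a by auto
      have Fb: "F ((T ^^ j) x) \<le> real K + a * real n" if "j < n" for j n
      proof -
        have "F ((T ^^ j) x) \<le> real K + r K ((T ^^ j) x)" by (auto simp: r_def)
        also have "r K ((T ^^ j) x) \<le> (\<Sum>k<n. r K ((T ^^ k) x))"
          using that by (intro member_le_sum) (auto simp: r_def)
        also have "\<dots> \<le> a * real n" by (rule K)
        finally show ?thesis by simp
      qed
      have main: "g n x \<le> c' * real n + e/3 * real n + (real N + 1) * (real K + a * real n)" if n: "n \<ge> 1" for n
      proof -
        \<comment> \<open>The covering asks for a positive maximal block length, hence
          \<open>Suc N\<close>; returning to N is possible because \<open>B\<close> decreases in
          N.\<close>
        have "g n ((T ^^ 0) x) \<le> c' * real n + (\<Sum>j=0..<0+n. h (Suc N) ((T ^^ j) x)) + (\<Sum>j=0+n-Suc N..<0+n. F ((T ^^ j) x))"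
        proof (rule subadditive_covering[where G="\<lambda>k n. g n ((T ^^ k) x)"])
          show "g 1 ((T ^^ j) x) \<le> c' + h (Suc N) ((T ^^ j) x) \<or> (\<exists>l\<in>{1..Suc N}. g l ((T ^^ j) x) \<le> c' * real l)" for j
          proof (cases "(T ^^ j) x \<in> B (Suc N)")
            case True
            then show ?thesis by (auto simp: h_def F_def)
          next
            case False
            then show ?thesis using low[of j] by (auto simp: B_def not_less)
          qed
        qed (use elim(3) F0 h0 n in \<open>auto simp: F_def\<close>)
        also have "(\<Sum>j=0..<0+n. h (Suc N) ((T ^^ j) x)) \<le> (\<Sum>j<n. h N ((T ^^ j) x))"
          unfolding atLeast0LessThan add_0 h_def
          by (intro sum_mono mult_left_mono F0) (auto simp: indicator_def B_def)
        also have "\<dots> \<le> e/3 * real n" by (rule N)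
        also have "(\<Sum>j=0+n-Suc N..<0+n. F ((T ^^ j) x)) \<le> of_nat (card {0+n-Suc N..<0+n}) * (real K + a * real n)"
          by (rule sum_bounded_above) (auto intro: Fb)
        also have "\<dots> \<le> (real N + 1) * (real K + a * real n)"
          using a by (intro mult_right_mono) auto
        finally show ?thesis by simp
      qed
      have aN: "(real N + 1) * a = e/3" unfolding a_def by (simp add: divide_simps)
      obtain n0 :: nat where n0: "(real N + 1) * real K / (e/3) \<le> real n0" using real_arch_simple by blast
      show "\<forall>\<^sub>F n in sequentially. g n x \<le> (c' + e) * real n"
        unfolding eventually_sequentially
      proof (intro exI[of _ "max 1 n0"] allI impI)
        fix n assume n: "max 1 n0 \<le> n"
        have "(real N + 1) * real K / (e/3) \<le> real n" using n0 n by linarith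
        then have "(real N + 1) * real K \<le> e/3 * real n" using e by (simp add: field_simps)
        moreover have "(real N + 1) * (real K + a * real n) = (real N + 1) * real K + e/3 * real n"
          by (simp only: distrib_left mult.assoc[symmetric] aN)
        ultimately show "g n x \<le> (c' + e) * real n"
          using main[of n] n by (simp add: algebra_simps)
      qed
    qed
  qed
qed

text \<open>If liminf < limsup, choose d < c < c' < d' strictly between them with c, c' rational:
  then x is in \<open>low c\<close> with slack 0, and \<open>AE_upper_le\<close> with e = d' - c'
  pushes the limsup down to d'. Rational levels leave a single null set. The common value may be
  -\<infinity>, since only the positive part of \<open>g 1\<close> is integrable.\<close>

theorem AE_limsup_le_liminf:
  "AE x in \<nu>. limsup (\<lambda>n. ereal (g n x / real n)) \<le> liminf (\<lambda>n. ereal (g n x / real n)) \<and>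
     limsup (\<lambda>n. ereal (g n x / real n)) < \<infinity>"
proof -
  have "AE x in \<nu>. \<forall>c\<in>\<rat>. \<forall>c'\<in>\<rat>. c < c' \<longrightarrow> x \<in> low c \<longrightarrow> (\<forall>e>0. \<forall>\<^sub>F n in sequentially. g n x \<le> (c' + e) * real n)"
  proof (intro AE_ball_countable[THEN iffD2] countable_rat ballI)
    fix c c' :: real
    show "AE x in \<nu>. c < c' \<longrightarrow> x \<in> low c \<longrightarrow> (\<forall>e>0. \<forall>\<^sub>F n in sequentially. g n x \<le> (c' + e) * real n)"
      using AE_upper_le[of c c'] by (cases "c < c'") auto
  qed
  with AE_linear_bound AE_space show ?thesis
  proof eventually_elim
    case (elim x)
    let ?u = "\<lambda>n. ereal (g n x / real n)"
    have up: "limsup ?u \<le> ereal d" if "\<forall>\<^sub>F n in sequentially. g n x \<le> d * real n" for d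
      by (rule Limsup_bounded, use that eventually_gt_at_top[of "0::nat"] in eventually_elim) (simp add: field_simps)
    from elim(1) obtain C where "\<And>n. n \<ge> 1 \<Longrightarrow> g n x \<le> C * real n" by blast
    then have "limsup ?u \<le> ereal C" by (intro up) (auto simp: eventually_sequentially)
    then have fin: "limsup ?u < \<infinity>" by (rule le_less_trans) simp
    have "limsup ?u \<le> liminf ?u"
    proof (rule ccontr)
      assume "\<not> ?thesis"
      then have "liminf ?u < limsup ?u" by simp
      then obtain d where d: "liminf ?u < ereal d" "ereal d < limsup ?u" using ereal_dense2 by blast
      obtain d' where d': "ereal d < ereal d'" "ereal d' < limsup ?u" using ereal_dense2[OF d(2)] by blast
      obtain c where c: "c \<in> \<rat>" "d < c" "c < d'" using Rats_dense_in_real d'(1) by auto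
      obtain c' where c': "c' \<in> \<rat>" "c < c'" "c' < d'" using Rats_dense_in_real[OF c(3)] by auto
      have "\<exists>n\<ge>n0. g n x \<le> c * real n + real 0" for n0
      proof -
        have "\<not> (\<forall>\<^sub>F n in sequentially. ereal d \<le> ?u n)"
          using Liminf_bounded[of "ereal d" ?u sequentially] d(1) by (auto simp: not_less[symmetric])
        then have "\<And>N. \<exists>n\<ge>N. g n x / real n < d"
          unfolding eventually_sequentially by (auto simp: not_le)
        then obtain n where n: "n \<ge> max 1 n0" "g n x / real n < d" by blast
        then have "g n x / real n \<le> c" using c by linarith
        then have "g n x \<le> c * real n" using n(1) by (simp add: field_simps)
        then show ?thesis using n(1) by (intro exI[of _ n]) auto
      qed
      then have "x \<in> low c"
        unfolding low_def using elim(2) by blast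
      then have "\<forall>\<^sub>F n in sequentially. g n x \<le> (c' + (d' - c')) * real n"
        using elim(3)[rule_format, of c c' "d' - c'"] c c' by simp
      then have "limsup ?u \<le> ereal d'" using up by simp
      then show False using d'(2) by simp
    qed
    with fin show ?case by blast
  qed
qed

end

section \<open>Growth of products on vectors\<close>

lemma elog_le_iff: "elog x \<le> ereal c \<longleftrightarrow> x \<le> exp c"
proof (cases "x \<le> 0")
  case True
  then have "x \<le> exp c" using exp_gt_zero[of c] by linarith
  then show ?thesis using True by (simp add: elog_def)
next
  case False
  then show ?thesis using ln_le_cancel_iff[of x "exp c"] by (simp add: elog_def)
qed

lemma elog_div_le_iff: 
  assumes "n > 0"
  shows "elog x / ereal (real n) \<le> ereal d \<longleftrightarrow> x \<le> exp (d * real n)"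
proof -
  have "elog x / ereal (real n) \<le> ereal d \<longleftrightarrow> elog x \<le> ereal d * ereal (real n)"
    using assms by (subst ereal_divide_le_pos) (auto simp: mult.commute)
  then show ?thesis using elog_le_iff by simp
qed

lemma ereal_real_dense:
  assumes "\<mu> < ereal d"
  shows "\<exists>d'. \<mu> < ereal d' \<and> d' < d"
  using ereal_dense2[OF assms] by auto

text \<open>Turns rates into eventual exponential bounds with real d, where sums and products can be
  estimated without extended arithmetic. The cases \<mu> = -\<infinity> (all d) and \<mu> =
  \<infinity> (no d) are included, and the quotient at index 0 is irrelevant eventually.\<close>

lemma limsup_elog_le_iff:
  "limsup (\<lambda>n. elog (f n) / ereal (real n)) \<le> \<mu> \<longleftrightarrow>
     (\<forall>d. \<mu> < ereal d \<longrightarrow> (\<forall>\<^sub>F n in sequentially. f n \<le> exp (d * real n)))"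
proof (intro iffI allI impI)
  fix d assume "limsup (\<lambda>n. elog (f n) / ereal (real n)) \<le> \<mu>" "\<mu> < ereal d"
  then have "limsup (\<lambda>n. elog (f n) / ereal (real n)) < ereal d" by simp
  from Limsup_lessD[OF this] eventually_gt_at_top[of 0]
  show "\<forall>\<^sub>F n in sequentially. f n \<le> exp (d * real n)"
    by eventually_elim (use elog_div_le_iff less_imp_le in blast)
next
  assume *: "\<forall>d. \<mu> < ereal d \<longrightarrow> (\<forall>\<^sub>F n in sequentially. f n \<le> exp (d * real n))"
  show "limsup (\<lambda>n. elog (f n) / ereal (real n)) \<le> \<mu>"
  proof (rule ccontr)
    assume "\<not> ?thesis"
    then have "\<mu> < limsup (\<lambda>n. elog (f n) / ereal (real n))" by simp
    then obtain d where d: "\<mu> < ereal d" "ereal d < limsup (\<lambda>n. elog (f n) / ereal (real n))"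
      using ereal_dense2 by blast
    have "\<forall>\<^sub>F n in sequentially. f n \<le> exp (d * real n)" using * d(1) by blast
    then have "\<forall>\<^sub>F n in sequentially. elog (f n) / ereal (real n) \<le> ereal d"
      using eventually_gt_at_top[of 0] by eventually_elim (simp add: elog_div_le_iff)
    then have "limsup (\<lambda>n. elog (f n) / ereal (real n)) \<le> ereal d" by (rule Limsup_bounded)
    then show False using d(2) by simp
  qed
qed

lemma eventually_const_mult_exp_le:
  fixes C d d' :: real
  assumes "d < d'"
  shows "\<forall>\<^sub>F n in sequentially. C * exp (d * real n) \<le> exp (d' * real n)"
proof -
  obtain n0 :: nat where n0: "ln (max 1 C) / (d' - d) \<le> real n0" using real_arch_simple by blast
  show ?thesis
    unfolding eventually_sequentially
  proof (intro exI[of _ n0] allI impI)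
    fix n assume "n0 \<le> n"
    then have "ln (max 1 C) / (d' - d) \<le> real n" using n0 by linarith
    then have "ln (max 1 C) \<le> (d' - d) * real n" using assms by (simp add: field_simps)
    then have "exp (ln (max 1 C)) \<le> exp ((d' - d) * real n)" by (simp del: exp_ln_iff exp_ln)
    then have "C \<le> exp ((d' - d) * real n)" by simp
    then have "C * exp (d * real n) \<le> exp ((d' - d) * real n) * exp (d * real n)"
      by (intro mult_right_mono) auto
    also have "\<dots> = exp (d' * real n)" by (simp add: exp_add[symmetric] algebra_simps)
    finally show "C * exp (d * real n) \<le> exp (d' * real n)" .
  qed
qed

lemma lyap_le_iff:
  "lyap a x \<le> \<mu> \<longleftrightarrow>
     (\<forall>d. \<mu> < ereal d \<longrightarrow> (\<forall>\<^sub>F n in sequentially. norm (mat_prod a n *v x) \<le> exp (d * real n)))"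
  unfolding lyap_def by (rule limsup_elog_le_iff)

lemma lyap_zero [simp]: "lyap a 0 = -\<infinity>"
proof -
  have "lyap a 0 \<le> -\<infinity>" by (subst lyap_le_iff) auto
  then show ?thesis by simp
qed

lemma subspace_lyap_space: "subspace (lyap_space a \<mu>)"
proof (rule subspaceI)
  show "0 \<in> lyap_space a \<mu>" by (simp add: lyap_space_def)
next
  fix x y assume xy: "x \<in> lyap_space a \<mu>" "y \<in> lyap_space a \<mu>"
  show "x + y \<in> lyap_space a \<mu>"
    unfolding lyap_space_def mem_Collect_eq lyap_le_iff
  proof (intro allI impI)
    fix d assume "\<mu> < ereal d"
    then obtain d' where d': "\<mu> < ereal d'" "d' < d" using ereal_real_dense by blast
    have "\<forall>\<^sub>F n in sequentially. norm (mat_prod a n *v x) \<le> exp (d' * real n)"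
      "\<forall>\<^sub>F n in sequentially. norm (mat_prod a n *v y) \<le> exp (d' * real n)"
      using xy d'(1) by (auto simp: lyap_space_def lyap_le_iff)
    with eventually_const_mult_exp_le[OF d'(2), of 2]
    show "\<forall>\<^sub>F n in sequentially. norm (mat_prod a n *v (x + y)) \<le> exp (d * real n)"
    proof eventually_elim
      case (elim n)
      have "norm (mat_prod a n *v (x + y)) \<le> norm (mat_prod a n *v x) + norm (mat_prod a n *v y)"
        by (simp add: matrix_vector_right_distrib norm_triangle_ineq)
      with elim show ?case by linarith
    qed
  qed
next
  fix c x assume x: "x \<in> lyap_space a \<mu>"
  show "c *\<^sub>R x \<in> lyap_space a \<mu>"
    unfolding lyap_space_def mem_Collect_eq lyap_le_iff
  proof (intro allI impI)
    fix d assume "\<mu> < ereal d"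
    then obtain d' where d': "\<mu> < ereal d'" "d' < d" using ereal_real_dense by blast
    have "\<forall>\<^sub>F n in sequentially. norm (mat_prod a n *v x) \<le> exp (d' * real n)"
      using x d'(1) by (auto simp: lyap_space_def lyap_le_iff)
    with eventually_const_mult_exp_le[OF d'(2), of "\<bar>c\<bar>"]
    show "\<forall>\<^sub>F n in sequentially. norm (mat_prod a n *v (c *\<^sub>R x)) \<le> exp (d * real n)"
    proof eventually_elim
      case (elim n)
      have "norm (mat_prod a n *v (c *\<^sub>R x)) = \<bar>c\<bar> * norm (mat_prod a n *v x)"
        by (simp add: matrix_vector_mult_scaleR)
      also have "\<dots> \<le> \<bar>c\<bar> * exp (d' * real n)" using elim by (intro mult_left_mono) auto
      finally show ?case using elim by linarith
    qed
  qed
qed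

text \<open>The dimension of the sublevel space grows strictly from one value to the next, which
  injects the values into {0..p}.\<close>

lemma finite_lyap_values: "finite (lyap (a :: nat \<Rightarrow> real^'p^'p) ` (UNIV - {0}))"
proof -
  let ?S = "lyap a ` (UNIV - {0})"
  have less: "dim (lyap_space a \<mu>) < dim (lyap_space a \<mu>')" if "\<mu> < \<mu>'" "\<mu>' \<in> ?S" for \<mu> \<mu>'
  proof (rule dim_psubset)
    have sp: "span (lyap_space a \<mu>) = lyap_space a \<mu>" for \<mu>
      using subspace_lyap_space span_eq_iff by blast
    show "span (lyap_space a \<mu>) \<subset> span (lyap_space a \<mu>')"
      unfolding sp using that unfolding lyap_space_def psubset_eq by (force simp: set_eq_iff)
  qed
  have "inj_on (\<lambda>\<mu>. dim (lyap_space a \<mu>)) ?S"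
  proof (rule inj_onI)
    fix \<mu> \<mu>' assume "\<mu> \<in> ?S" "\<mu>' \<in> ?S" "dim (lyap_space a \<mu>) = dim (lyap_space a \<mu>')"
    then show "\<mu> = \<mu>'" using less[of \<mu> \<mu>'] less[of \<mu>' \<mu>] by (cases \<mu> \<mu>' rule: linorder_cases) auto
  qed
  moreover have "(\<lambda>\<mu>. dim (lyap_space a \<mu>)) ` ?S \<subseteq> {..DIM(real^'p)}"
    using dim_subset_UNIV by (auto simp del: DIM_cart)
  ultimately show ?thesis using finite_imageD finite_subset by blast
qed

text \<open>Decodes the list encoding. Two copies of the largest value at the head of the spectrum
  would make \<lambda>_1 = \<lambda>_2, so the top multiplicity is 1; the second entry is then the
  next distinct value, and its sublevel space is a hyperplane.\<close>

lemma spectral_gap_flag: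
  fixes a :: "nat \<Rightarrow> real^'p^'p"
  assumes card: "CARD('p) \<ge> 2"
    and gap: "lyapunov_exponent a 2 < lyapunov_exponent a 1"
  shows "lyap a x \<le> lyapunov_exponent a 1"
    and "\<exists>x. lyap a x = lyapunov_exponent a 1"
    and "lyap_space a (lyapunov_exponent a 2) = {x. lyap a x < lyapunov_exponent a 1}"
    and "dim (lyap_space a (lyapunov_exponent a 2)) = CARD('p) - 1"
    and "\<exists>z. z \<noteq> 0 \<and> lyap a z = lyapunov_exponent a 2"
proof -
  define S where "S = lyap a ` (UNIV - {0})"
  define vs where "vs = lyap_values a"
  define m where "m = (\<lambda>r. dim (lyap_flag a r) - dim (lyap_flag a (Suc r)))"
  have finS: "finite S" unfolding S_def by (rule finite_lyap_values)
  have vs: "vs = rev (sorted_list_of_set S)" by (simp add: vs_def lyap_values_def S_def)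
  have set_vs: "set vs = S" using finS by (simp add: vs)
  have "(1 :: real^'p) \<noteq> 0" by simp
  then have "S \<noteq> {}" unfolding S_def by blast
  then have len: "0 < length vs" using set_vs by auto
  have dec: "vs ! j < vs ! i" if "i < j" "j < length vs" for i j
  proof -
    have "sorted_wrt (<) (sorted_list_of_set S)" by (rule strict_sorted_list_of_set)
    then have "sorted_wrt (>) vs" by (simp add: vs sorted_wrt_rev)
    then show ?thesis using that sorted_wrt_nth_less by blast
  qed
  have vs0: "lyap a x \<le> vs ! 0" for x
  proof (cases "x = 0")
    case False
    then have "lyap a x \<in> set vs" using set_vs S_def by auto
    then obtain i where "i < length vs" "lyap a x = vs ! i" by (metis in_set_conv_nth)
    then show ?thesis using dec[of 0 i] by (cases i) auto
  qed simp
  have flag_sub: "subspace (lyap_flag a r)" for r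
    by (simp add: lyap_flag_def subspace_lyap_space)
  have attained: "\<exists>x. x \<noteq> 0 \<and> lyap a x = vs ! r" if "r < length vs" for r
    using nth_mem[OF that] unfolding set_vs S_def by force
  have m_pos: "0 < m r" if r: "r < length vs" for r
  proof -
    obtain x where x: "x \<noteq> 0" "lyap a x = vs ! r" using attained[OF r] by blast
    have "x \<in> lyap_flag a r" "x \<notin> lyap_flag a (Suc r)"
      using x r dec[of r "Suc r"] by (auto simp: lyap_flag_def lyap_space_def vs_def[symmetric])
    moreover have "lyap_flag a (Suc r) \<subseteq> lyap_flag a r"
      using r dec[of r "Suc r"] by (auto simp: lyap_flag_def lyap_space_def vs_def[symmetric])
    ultimately have "span (lyap_flag a (Suc r)) \<subset> span (lyap_flag a r)"
      using flag_sub by (metis psubsetI span_eq_iff)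
    from dim_psubset[OF this] show ?thesis unfolding m_def by simp
  qed
  have spec: "lyap_spectrum a = concat (map (\<lambda>r. replicate (m r) (vs ! r)) [0..<length vs])"
    by (simp add: lyap_spectrum_def m_def vs_def)
  have spec0: "lyap_spectrum a = replicate (m 0) (vs ! 0) @ concat (map (\<lambda>r. replicate (m r) (vs ! r)) [1..<length vs])"
    using len by (simp add: spec upt_conv_Cons)
  have l1: "lyapunov_exponent a 1 = vs ! 0"
    using m_pos[OF len] by (simp add: lyapunov_exponent_def spec0 nth_append)
  have m0: "m 0 = 1"
  proof (rule ccontr)
    assume "m 0 \<noteq> 1"
    then have "m 0 \<ge> 2" using m_pos[OF len] by linarith
    then have "lyapunov_exponent a 2 = vs ! 0"
      by (simp add: lyapunov_exponent_def spec0 nth_append)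
    then show False using gap l1 by simp
  qed
  have "lyap_flag a 0 = UNIV" using vs0 len by (auto simp: lyap_flag_def lyap_space_def vs_def[symmetric])
  then have dim0: "dim (lyap_flag a 0) = CARD('p)" by simp
  have dim1: "dim (lyap_flag a 1) = CARD('p) - 1" using m0 dim0 card by (simp add: m_def)
  \<comment> \<open>Without a second value the next flag space would be {0}, of dimension 0 instead
    of p - 1 \<ge> 1.\<close>
  have len2: "1 < length vs"
  proof (rule ccontr)
    assume "\<not> ?thesis"
    then have "lyap_flag a 1 = {0}" by (simp add: lyap_flag_def vs_def)
    then show False using dim1 card by simp
  qed
  have l2: "lyapunov_exponent a 2 = vs ! 1"
  proof -
    have "lyap_spectrum a = vs ! 0 # replicate (m 1) (vs ! 1) @ concat (map (\<lambda>r. replicate (m r) (vs ! r)) [2..<length vs])"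
      using len2 m0 by (simp add: spec0 upt_conv_Cons numeral_2_eq_2)
    then show ?thesis using m_pos[OF len2] by (simp add: lyapunov_exponent_def nth_append)
  qed
  show "lyap a x \<le> lyapunov_exponent a 1" using vs0 l1 by simp
  show "\<exists>x. lyap a x = lyapunov_exponent a 1" using attained[OF len] l1 by auto
  show "\<exists>z. z \<noteq> 0 \<and> lyap a z = lyapunov_exponent a 2" using attained[OF len2] l2 by auto
  have "lyap_flag a 1 = lyap_space a (lyapunov_exponent a 2)"
    using len2 l2 by (simp add: lyap_flag_def vs_def)
  with dim1 show "dim (lyap_space a (lyapunov_exponent a 2)) = CARD('p) - 1" by simp
  have "lyap a x \<le> vs ! 1" if "lyap a x < vs ! 0" for x
  proof (cases "x = 0")
    case False
    then have "lyap a x \<in> set vs" using set_vs S_def by auto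
    then obtain i where i: "i < length vs" "lyap a x = vs ! i" by (metis in_set_conv_nth)
    then have "i \<noteq> 0" using that by (cases i) auto
    then show ?thesis using dec[of 1 i] i by (cases "i = 1") auto
  qed simp
  moreover have "vs ! 1 < vs ! 0" using gap l1 l2 by simp
  ultimately show "lyap_space a (lyapunov_exponent a 2) = {x. lyap a x < lyapunov_exponent a 1}"
    unfolding lyap_space_def l1 l2 by (auto intro: le_less_trans)
qed

section \<open>Products of nonnegative matrices\<close>

text \<open>On nonnegative matrices this is the entrywise l1 norm. It is submultiplicative there, so
  its logarithm is a subadditive cocycle, and it splits into row sums and column sums.\<close>

definition entry_sum :: "real^'n^'m \<Rightarrow> real" where
  "entry_sum B = (\<Sum>i\<in>UNIV. \<Sum>j\<in>UNIV. B $ i $ j)"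

lemma nonneg_matrix_mult: "nonneg_matrix A \<Longrightarrow> nonneg_matrix B \<Longrightarrow> nonneg_matrix (A ** B)"
  by (auto simp: nonneg_matrix_def matrix_matrix_mult_def intro!: sum_nonneg)

lemma nonneg_matrix_mat_1: "nonneg_matrix (mat 1)"
  by (auto simp: nonneg_matrix_def mat_def)

lemma column_allowable_mult:
  assumes "nonneg_matrix A" "nonneg_matrix B" "column_allowable A" "column_allowable B"
  shows "column_allowable (A ** B)"
  unfolding column_allowable_def
proof
  fix j
  obtain k where k: "0 < B $ k $ j" using assms(4) by (auto simp: column_allowable_def)
  obtain i where i: "0 < A $ i $ k" using assms(3) by (auto simp: column_allowable_def)
  have "0 < A $ i $ k * B $ k $ j" using i k by simp
  also have "\<dots> \<le> (\<Sum>k\<in>UNIV. A $ i $ k * B $ k $ j)"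
    using assms(1,2) by (intro member_le_sum) (auto simp: nonneg_matrix_def)
  finally show "\<exists>i. 0 < (A ** B) $ i $ j" by (auto simp: matrix_matrix_mult_def)
qed

lemma column_allowable_mat_1: "column_allowable (mat 1)"
  by (auto simp: column_allowable_def mat_def)

lemma nonneg_mat_prod:
  assumes "\<And>n. n \<ge> 1 \<Longrightarrow> nonneg_matrix (a n)"
  shows "nonneg_matrix (mat_prod a n)"
  by (induction n) (auto simp: nonneg_matrix_mat_1 nonneg_matrix_mult assms)

lemma column_allowable_mat_prod:
  assumes "\<And>n. n \<ge> 1 \<Longrightarrow> nonneg_matrix (a n)" "\<And>n. n \<ge> 1 \<Longrightarrow> column_allowable (a n)"
  shows "column_allowable (mat_prod a n)"
  by (induction n) (auto simp: column_allowable_mat_1 column_allowable_mult nonneg_mat_prod assms)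

lemma row_sum_le_entry_sum:
  assumes "nonneg_matrix B"
  shows "(\<Sum>j\<in>UNIV. B $ i $ j) \<le> entry_sum B"
  unfolding entry_sum_def
  using assms by (intro member_le_sum[of i UNIV "\<lambda>i. \<Sum>j\<in>UNIV. B $ i $ j"]) (auto simp: nonneg_matrix_def intro!: sum_nonneg)

lemma entry_le_entry_sum:
  assumes "nonneg_matrix B"
  shows "B $ i $ j \<le> entry_sum B"
proof -
  have "B $ i $ j \<le> (\<Sum>j\<in>UNIV. B $ i $ j)"
    using assms by (intro member_le_sum[of j UNIV "\<lambda>j. B $ i $ j"]) (auto simp: nonneg_matrix_def)
  then show ?thesis using row_sum_le_entry_sum[OF assms, of i] by linarith
qed

lemma entry_sum_pos:
  assumes "nonneg_matrix B" "column_allowable B"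
  shows "0 < entry_sum B"
  using assms(2) entry_le_entry_sum[OF assms(1)] unfolding column_allowable_def by (meson less_le_trans)

lemma entry_sum_mult_le:
  assumes A: "nonneg_matrix A" and B: "nonneg_matrix B"
  shows "entry_sum (A ** B) \<le> entry_sum A * entry_sum B"
proof -
  have "entry_sum (A ** B) = (\<Sum>i\<in>UNIV. \<Sum>j\<in>UNIV. \<Sum>k\<in>UNIV. A $ i $ k * B $ k $ j)"
    by (simp add: entry_sum_def matrix_matrix_mult_def)
  also have "\<dots> = (\<Sum>i\<in>UNIV. \<Sum>k\<in>UNIV. A $ i $ k * (\<Sum>j\<in>UNIV. B $ k $ j))"
    by (simp add: sum_distrib_left) (intro sum.cong refl sum.swap)
  also have "\<dots> \<le> (\<Sum>i\<in>UNIV. \<Sum>k\<in>UNIV. A $ i $ k * entry_sum B)"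
    using A row_sum_le_entry_sum[OF B] by (intro sum_mono mult_left_mono) (auto simp: nonneg_matrix_def)
  also have "\<dots> = entry_sum A * entry_sum B"
    by (simp add: entry_sum_def[of A] sum_distrib_right)
  finally show ?thesis .
qed

lemma norm_mult_vec_le_entry_sum:
  assumes "nonneg_matrix B"
  shows "norm (B *v x) \<le> entry_sum B * norm x"
proof -
  have "norm (B *v x) \<le> (\<Sum>i\<in>UNIV. \<bar>(B *v x) $ i\<bar>)" by (rule norm_le_l1_cart)
  also have "\<dots> \<le> (\<Sum>i\<in>UNIV. \<Sum>j\<in>UNIV. B $ i $ j * norm x)"
  proof (rule sum_mono)
    fix i
    have "\<bar>(B *v x) $ i\<bar> \<le> (\<Sum>j\<in>UNIV. \<bar>B $ i $ j * x $ j\<bar>)"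
      by (simp add: matrix_vector_mult_def sum_abs)
    also have "\<dots> \<le> (\<Sum>j\<in>UNIV. B $ i $ j * norm x)"
      using assms component_le_norm_cart[of x] by (intro sum_mono) (auto simp: abs_mult nonneg_matrix_def intro!: mult_left_mono)
    finally show "\<bar>(B *v x) $ i\<bar> \<le> (\<Sum>j\<in>UNIV. B $ i $ j * norm x)" .
  qed
  also have "\<dots> = entry_sum B * norm x" by (simp add: entry_sum_def sum_distrib_right)
  finally show ?thesis .
qed

lemma sum_components_le_norm: "(\<Sum>i\<in>UNIV. x $ i) \<le> real CARD('n) * norm (x :: real^'n)"
proof -
  have "(\<Sum>i\<in>UNIV. x $ i) \<le> (\<Sum>i::'n\<in>UNIV. norm x)"
    using component_le_norm_cart[of x] by (intro sum_mono) (auto simp: abs_le_iff)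
  then show ?thesis by simp
qed

text \<open>For nonnegative matrices this complements \<open>norm_mult_vec_le_entry_sum\<close>:
  growth is already seen at the all-ones vector, which therefore attains the top exponent.\<close>

lemma entry_sum_le_norm_mult_1: "entry_sum B \<le> real CARD('m) * norm ((B :: real^'n^'m) *v 1)"
proof -
  have "entry_sum B = (\<Sum>i\<in>UNIV. (B *v 1) $ i)"
    by (simp add: entry_sum_def matrix_vector_mult_def)
  then show ?thesis using sum_components_le_norm by metis
qed

section \<open>Right directions of a product and the nonnegative normal of a hyperplane\<close>

definition column_sums :: "real^'n^'m \<Rightarrow> real^'n" where
  "column_sums B = (\<chi> j. \<Sum>i\<in>UNIV. B $ i $ j)"

lemma inner_column_sums: "column_sums B \<bullet> y = (\<Sum>i\<in>UNIV. (B *v y) $ i)"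
proof -
  have "column_sums B \<bullet> y = (\<Sum>j\<in>UNIV. \<Sum>i\<in>UNIV. B $ i $ j * y $ j)"
    by (simp add: column_sums_def inner_vec_def sum_distrib_right)
  also have "\<dots> = (\<Sum>i\<in>UNIV. \<Sum>j\<in>UNIV. B $ i $ j * y $ j)" by (rule sum.swap)
  finally show ?thesis by (simp add: matrix_vector_mult_def)
qed

lemma abs_inner_column_sums_le:
  "\<bar>column_sums B \<bullet> y\<bar> \<le> real CARD('m) * norm ((B :: real^'n^'m) *v y)"
proof -
  have "\<bar>column_sums B \<bullet> y\<bar> \<le> (\<Sum>i\<in>UNIV. \<bar>(B *v y) $ i\<bar>)"
    unfolding inner_column_sums by (rule sum_abs)
  also have "\<dots> \<le> (\<Sum>i::'m\<in>UNIV. norm (B *v y))"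
    by (intro sum_mono component_le_norm_cart)
  finally show ?thesis by simp
qed

lemma entry_sum_le_norm_column_sums:
  "entry_sum B \<le> real CARD('n) * norm (column_sums (B :: real^'n^'m))"
proof -
  have "entry_sum B = (\<Sum>j\<in>UNIV. column_sums B $ j)"
    unfolding entry_sum_def column_sums_def by (simp, rule sum.swap)
  then show ?thesis using sum_components_le_norm[of "column_sums B"] by simp
qed

lemma norm_orthogonal_matrix_mult:
  "orthogonal_matrix (U :: real^'n^'n) \<Longrightarrow> norm (U *v x) = norm x"
  using orthogonal_transformation_matrix[of "\<lambda>x. U *v x"] by (simp add: orthogonal_transformation)

lemma norm_leading_right_singular_vector:
  "leading_right_singular_vector B v \<Longrightarrow> norm v = 1"
  unfolding leading_right_singular_vector_def is_svd_def
  using orthogonal_matrix_orthonormal_rows by blast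

text \<open>With \<sigma> the largest singular value, \<sigma> |v \<bullet> y| is the modulus of one
  coordinate of S V y, a vector of norm |B y|. One factor p compares the entry sum with |B 1| \<le>
  \<sigma> |1|, the other is the crude bound |1| \<le> p.\<close>

lemma abs_inner_leading_right_singular_vector_le:
  fixes B :: "real^('p::{finite,linorder})^('p::{finite,linorder})"
  assumes v: "leading_right_singular_vector B v" and B: "nonneg_matrix B"
  shows "entry_sum B * \<bar>v \<bullet> y\<bar> \<le> (real CARD('p))\<^sup>2 * norm (B *v y)"
proof -
  let ?p = "real CARD('p)"
  define m where "m = Min (UNIV :: 'p set)"
  from v obtain U S V where svd: "is_svd B U S V" and v: "v = row m V"
    by (auto simp: leading_right_singular_vector_def m_def)
  have U: "orthogonal_matrix U" and V: "orthogonal_matrix V" and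
    off: "\<And>i j. i \<noteq> j \<Longrightarrow> S $ i $ j = 0" and diag: "\<And>i. 0 \<le> S $ i $ i" and
    dec: "\<And>i j. i \<le> j \<Longrightarrow> S $ j $ j \<le> S $ i $ i" and eq: "B = U ** S ** V"
    using svd by (auto simp: is_svd_def)
  have m: "m \<le> i" for i unfolding m_def by simp
  have Sz: "(S *v z) $ i = S $ i $ i * z $ i" for z i
  proof -
    have "(S *v z) $ i = (\<Sum>j\<in>UNIV. S $ i $ j * z $ j)"
      by (simp add: matrix_vector_mult_def)
    also have "\<dots> = (\<Sum>j\<in>UNIV. if j = i then S $ i $ i * z $ i else 0)"
      by (rule sum.cong) (use off in auto)
    finally show ?thesis by simp
  qed
  have nB: "norm (B *v z) = norm (S *v (V *v z))" for z
    unfolding eq by (simp add: norm_orthogonal_matrix_mult[OF U] matrix_vector_mul_assoc[symmetric])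
  have "norm (S *v z) \<le> S $ m $ m * norm z" for z
  proof -
    have "norm (S *v z) \<le> norm (S $ m $ m *\<^sub>R z)"
      using dec[OF m] diag by (intro norm_le_componentwise_cart) (auto simp: Sz abs_mult intro!: mult_right_mono)
    then show ?thesis using diag by simp
  qed
  from this[of "V *v 1"] have "norm (B *v 1) \<le> S $ m $ m * norm (1 :: real^('p::{finite,linorder}))"
    by (simp add: nB norm_orthogonal_matrix_mult[OF V])
  also have "norm (1 :: real^('p::{finite,linorder})) \<le> ?p"
    using norm_le_l1_cart[of "1 :: real^('p::{finite,linorder})"] by simp
  finally have "norm (B *v 1) \<le> S $ m $ m * ?p" using diag by (simp add: mult_left_mono)
  then have "entry_sum B \<le> ?p * (S $ m $ m * ?p)"
    using entry_sum_le_norm_mult_1[of B] by (meson mult_left_mono of_nat_0_le_iff order_trans)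
  then have le: "entry_sum B * \<bar>v \<bullet> y\<bar> \<le> ?p * (S $ m $ m * ?p) * \<bar>v \<bullet> y\<bar>"
    by (rule mult_right_mono) simp
  have "v \<bullet> y = (V *v y) $ m"
    by (simp add: v row_def matrix_vector_mult_def inner_vec_def)
  then have "S $ m $ m * \<bar>v \<bullet> y\<bar> = \<bar>(S *v (V *v y)) $ m\<bar>"
    using diag[of m] by (simp add: Sz abs_mult)
  then have "?p * (S $ m $ m * ?p) * \<bar>v \<bullet> y\<bar> = ?p\<^sup>2 * \<bar>(S *v (V *v y)) $ m\<bar>"
    by (simp add: power2_eq_square algebra_simps)
  also have "\<dots> \<le> ?p\<^sup>2 * norm (B *v y)"
    unfolding nB by (intro mult_left_mono component_le_norm_cart) auto
  finally show ?thesis using le by linarith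
qed

text \<open>Coordinate i of the remainder is u tested against e_i - v_i v, which is orthogonal to v.
  A nonnegative unit vector has coordinate sum at least 1, and the remainder eventually contributes
  less than 1/2, so the component along v carries the rest. The second claim is what fixes the sign
  of v later.\<close>

lemma unit_normal_limit_aux:
  fixes u :: "nat \<Rightarrow> real^'p" and v :: "real^'p"
  assumes v: "norm v = 1"
    and u: "\<forall>\<^sub>F n in sequentially. norm (u n) = 1 \<and> (\<forall>i. 0 \<le> u n $ i)"
    and lim: "\<And>y. v \<bullet> y = 0 \<Longrightarrow> (\<lambda>n. u n \<bullet> y) \<longlonglongrightarrow> 0"
  shows "(\<lambda>n. u n - (u n \<bullet> v) *\<^sub>R v) \<longlonglongrightarrow> 0"
    and "\<forall>\<^sub>F n in sequentially. 1/2 < (u n \<bullet> v) * (\<Sum>i\<in>UNIV. v $ i)"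
proof -
  show 1: "(\<lambda>n. u n - (u n \<bullet> v) *\<^sub>R v) \<longlonglongrightarrow> 0"
  proof (rule vec_tendstoI)
    fix i
    let ?y = "axis i 1 - (v $ i) *\<^sub>R v"
    have "v \<bullet> v = 1" using v by (simp add: norm_eq_1)
    then have "v \<bullet> ?y = 0" by (simp add: inner_diff_right inner_axis)
    from lim[OF this] show "(\<lambda>n. (u n - (u n \<bullet> v) *\<^sub>R v) $ i) \<longlonglongrightarrow> 0 $ i"
      by (simp add: inner_diff_right inner_axis mult.commute)
  qed
  have "(\<lambda>n. \<Sum>i\<in>UNIV. (u n - (u n \<bullet> v) *\<^sub>R v) $ i) \<longlonglongrightarrow> (\<Sum>i::'p\<in>UNIV. (0::real^'p) $ i)"
    by (intro tendsto_sum tendsto_vec_nth 1)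
  then have "\<forall>\<^sub>F n in sequentially. (\<Sum>i\<in>UNIV. (u n - (u n \<bullet> v) *\<^sub>R v) $ i) < 1/2"
    by (intro order_tendstoD) auto
  with u show "\<forall>\<^sub>F n in sequentially. 1/2 < (u n \<bullet> v) * (\<Sum>i\<in>UNIV. v $ i)"
  proof eventually_elim
    case (elim n)
    have "1 \<le> (\<Sum>i\<in>UNIV. \<bar>u n $ i\<bar>)" using elim(1) norm_le_l1_cart[of "u n"] by simp
    then have "1 \<le> (\<Sum>i\<in>UNIV. u n $ i)" using elim(1) by simp
    then show ?case using elim(2) by (simp add: sum_subtractf sum_distrib_left)
  qed
qed

text \<open>The remainder of u off v vanishes and u has norm 1, so |u \<bullet> v| tends to 1; the
  positive coordinate sum of v decides against the limit -v.\<close>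

lemma tendsto_unit_normal:
  fixes u :: "nat \<Rightarrow> real^'p" and v :: "real^'p"
  assumes v: "norm v = 1" and s: "0 < (\<Sum>i\<in>UNIV. v $ i)"
    and u: "\<forall>\<^sub>F n in sequentially. norm (u n) = 1 \<and> (\<forall>i. 0 \<le> u n $ i)"
    and lim: "\<And>y. v \<bullet> y = 0 \<Longrightarrow> (\<lambda>n. u n \<bullet> y) \<longlonglongrightarrow> 0"
  shows "u \<longlonglongrightarrow> v"
proof -
  have d: "(\<lambda>n. u n - (u n \<bullet> v) *\<^sub>R v) \<longlonglongrightarrow> 0"
    "\<forall>\<^sub>F n in sequentially. 1/2 < (u n \<bullet> v) * (\<Sum>i\<in>UNIV. v $ i)"
    by (rule unit_normal_limit_aux[OF v u]; rule lim; assumption)+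
  have "(\<lambda>n. \<bar>u n \<bullet> v\<bar> - 1) \<longlonglongrightarrow> 0"
  proof (rule Lim_null_comparison)
    show "(\<lambda>n. norm (u n - (u n \<bullet> v) *\<^sub>R v)) \<longlonglongrightarrow> 0" by (rule tendsto_norm_zero[OF d(1)])
    show "\<forall>\<^sub>F n in sequentially. norm (\<bar>u n \<bullet> v\<bar> - 1) \<le> norm (u n - (u n \<bullet> v) *\<^sub>R v)"
      using u
    proof eventually_elim
      case (elim n)
      have "norm ((u n \<bullet> v) *\<^sub>R v) = \<bar>u n \<bullet> v\<bar>" using v by simp
      then have "\<bar>\<bar>u n \<bullet> v\<bar> - norm (u n)\<bar> \<le> norm (u n - (u n \<bullet> v) *\<^sub>R v)"
        using norm_triangle_ineq3[of "(u n \<bullet> v) *\<^sub>R v" "u n"] by (metis norm_minus_commute)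
      then show ?case using elim by simp
    qed
  qed
  then have "(\<lambda>n. \<bar>u n \<bullet> v\<bar>) \<longlonglongrightarrow> 1" by (simp add: LIM_zero_iff)
  moreover have "\<forall>\<^sub>F n in sequentially. \<bar>u n \<bullet> v\<bar> = u n \<bullet> v"
    using d(2)
  proof eventually_elim
    case (elim n)
    then have "0 < (u n \<bullet> v) * (\<Sum>i\<in>UNIV. v $ i)" by linarith
    then show ?case using s by (simp add: zero_less_mult_iff)
  qed
  ultimately have "(\<lambda>n. u n \<bullet> v) \<longlonglongrightarrow> 1" using Lim_transform_eventually by fastforce
  then have "(\<lambda>n. (u n - (u n \<bullet> v) *\<^sub>R v) + (u n \<bullet> v) *\<^sub>R v) \<longlonglongrightarrow> 0 + 1 *\<^sub>R v"
    by (intro tendsto_intros d(1))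
  then show ?thesis by simp
qed

text \<open>A unit normal is unique up to sign. Its coordinate sum cannot vanish, by
  \<open>unit_normal_limit_aux\<close>; with the sign that makes it positive, the normal is the
  limit of the nonnegative u and inherits nonnegativity.\<close>

lemma nonneg_unit_normal_exists:
  fixes u :: "nat \<Rightarrow> real^'p"
  assumes H: "subspace H" "dim H = CARD('p) - 1"
    and u: "\<forall>\<^sub>F n in sequentially. norm (u n) = 1 \<and> (\<forall>i. 0 \<le> u n $ i)"
    and lim: "\<And>y. y \<in> H \<Longrightarrow> (\<lambda>n. u n \<bullet> y) \<longlonglongrightarrow> 0"
  obtains v where "norm v = 1" "\<And>i. 0 \<le> v $ i" "H = {y. v \<bullet> y = 0}"
proof -
  have "dim H < DIM(real^'p)" using H(2) by simp
  then obtain w where w: "w \<noteq> 0" "span H \<subseteq> {x. w \<bullet> x = 0}"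
    using lowdim_subset_hyperplane by blast
  have Hw: "H = {x. w \<bullet> x = 0}"
  proof (rule subspace_dim_equal[OF H(1) subspace_hyperplane])
    show "H \<subseteq> {x. w \<bullet> x = 0}" using w(2) span_superset by blast
    show "dim {x. w \<bullet> x = 0} \<le> dim H" using dim_hyperplane[OF w(1)] H(2) by simp
  qed
  have "\<exists>v. norm v = 1 \<and> 0 < (\<Sum>i\<in>UNIV. v $ i) \<and> H = {y. v \<bullet> y = 0}"
  proof -
    define w' where "w' = w /\<^sub>R norm w"
    have w': "norm w' = 1" "H = {y. w' \<bullet> y = 0}" using w(1) by (auto simp: w'_def Hw)
    have "\<forall>\<^sub>F n in sequentially. 1/2 < (u n \<bullet> w') * (\<Sum>i\<in>UNIV. w' $ i)"
      by (rule unit_normal_limit_aux(2)[OF w'(1) u]) (use w'(2) lim in auto)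
    then have "(\<Sum>i\<in>UNIV. w' $ i) \<noteq> 0"
      by (metis (mono_tags, lifting) eventually_happens half_gt_zero_iff less_asym mult_zero_right trivial_limit_sequentially zero_less_one)
    then consider "0 < (\<Sum>i\<in>UNIV. w' $ i)" | "0 < (\<Sum>i\<in>UNIV. (- w') $ i)"
      by (force simp: sum_negf)
    then show ?thesis
    proof cases
      case 1
      then show ?thesis using w' by blast
    next
      case 2
      then show ?thesis using w' by (intro exI[of _ "- w'"]) auto
    qed
  qed
  then obtain v where v: "norm v = 1" "0 < (\<Sum>i\<in>UNIV. v $ i)" "H = {y. v \<bullet> y = 0}" by blast
  have "u \<longlonglongrightarrow> v" by (rule tendsto_unit_normal[OF v(1,2) u]) (use v(3) lim in auto)
  then have "0 \<le> v $ i" for i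
    by (intro tendsto_lowerbound[OF tendsto_vec_nth[of u v]]) (use u in \<open>auto elim: eventually_mono\<close>)
  with v that show ?thesis by blast
qed

section \<open>Rate of the ratio error along one fixed realization\<close>

locale dominated_products =
  fixes a :: "nat \<Rightarrow> real^'p^'p" and l1 :: real and l2 :: ereal
  assumes nonneg_a: "\<And>n. n \<ge> 1 \<Longrightarrow> nonneg_matrix (a n)"
    and column_allowable_a: "\<And>n. n \<ge> 1 \<Longrightarrow> column_allowable (a n)"
    and growth: "(\<lambda>n. ln (entry_sum (mat_prod a n)) / real n) \<longlonglongrightarrow> l1"
    and gap: "l2 < ereal l1"
    and dim_slow: "dim (lyap_space a l2) = CARD('p) - 1"
    and l2_attained: "\<exists>z. z \<noteq> 0 \<and> lyap a z = l2"
begin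

abbreviation "E n \<equiv> entry_sum (mat_prod a n)"

lemma nonneg_prod: "nonneg_matrix (mat_prod a n)"
  by (rule nonneg_mat_prod[OF nonneg_a])

lemma column_allowable_prod: "column_allowable (mat_prod a n)"
  by (rule column_allowable_mat_prod[OF nonneg_a column_allowable_a])

lemma E_pos: "0 < E n"
  by (rule entry_sum_pos[OF nonneg_prod column_allowable_prod])

lemma E_lower:
  assumes "d < l1"
  shows "\<forall>\<^sub>F n in sequentially. exp (d * real n) \<le> E n"
  using order_tendstoD(1)[OF growth assms] eventually_gt_at_top[of 0]
proof eventually_elim
  case (elim n)
  then have "d * real n \<le> ln (E n)" by (simp add: field_simps)
  then have "exp (d * real n) \<le> exp (ln (E n))" by (simp only: exp_le_cancel_iff)
  then show ?case using E_pos[of n] by simp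
qed

lemma E_upper:
  assumes "l1 < d"
  shows "\<forall>\<^sub>F n in sequentially. E n \<le> exp (d * real n)"
  using order_tendstoD(2)[OF growth assms] eventually_gt_at_top[of 0]
proof eventually_elim
  case (elim n)
  then have "ln (E n) \<le> d * real n" by (simp add: field_simps)
  then have "exp (ln (E n)) \<le> exp (d * real n)" by (simp only: exp_le_cancel_iff)
  then show ?case using E_pos[of n] by simp
qed

lemma slow_relative_decay:
  assumes y: "y \<in> lyap_space a l2"
  shows "(\<lambda>n. norm (mat_prod a n *v y) / E n) \<longlonglongrightarrow> 0"
proof -
  obtain d where d: "l2 < ereal d" "d < l1" using ereal_dense2[OF gap] by auto
  obtain d' where d': "d < d'" "d' < l1" using dense[OF d(2)] by blast
  have "\<forall>\<^sub>F n in sequentially. norm (mat_prod a n *v y) \<le> exp (d * real n)"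
    using y d(1) by (auto simp: lyap_space_def lyap_le_iff)
  with E_lower[OF d'(2)]
  have "\<forall>\<^sub>F n in sequentially. norm (norm (mat_prod a n *v y) / E n) \<le> exp (d - d') ^ n"
  proof eventually_elim
    case (elim n)
    have "norm (mat_prod a n *v y) / E n \<le> exp (d * real n) / exp (d' * real n)"
      using elim by (intro frac_le) auto
    also have "\<dots> = exp (d - d') ^ n"
      by (simp add: exp_diff[symmetric] exp_of_nat_mult[symmetric] algebra_simps)
    finally show ?case using E_pos[of n] by simp
  qed
  moreover have "(\<lambda>n. exp (d - d') ^ n) \<longlonglongrightarrow> 0"
    using d' by (intro LIMSEQ_realpow_zero) auto
  ultimately show ?thesis by (rule Lim_null_comparison)
qed

text \<open>Isolates what leading right singular vectors and normalized column sums have in common: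
  a direction u along which M_n stretches at full strength. Slow vectors then become orthogonal to u
  in the limit.\<close>

definition top_right_directions :: "(nat \<Rightarrow> real^'p) \<Rightarrow> bool" where
  "top_right_directions u \<longleftrightarrow> (\<forall>\<^sub>F n in sequentially. norm (u n) = 1 \<and> (\<forall>i. 0 \<le> u n $ i)) \<and>
     (\<exists>C. \<forall>\<^sub>F n in sequentially. \<forall>y. E n * \<bar>u n \<bullet> y\<bar> \<le> C * norm (mat_prod a n *v y))"

lemma top_right_directions_tendsto_0:
  assumes "top_right_directions u" and y: "y \<in> lyap_space a l2"
  shows "(\<lambda>n. u n \<bullet> y) \<longlonglongrightarrow> 0"
proof -
  obtain C where C: "\<forall>\<^sub>F n in sequentially. \<forall>y. E n * \<bar>u n \<bullet> y\<bar> \<le> C * norm (mat_prod a n *v y)"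
    using assms(1) by (auto simp: top_right_directions_def)
  have "(\<lambda>n. C * (norm (mat_prod a n *v y) / E n)) \<longlonglongrightarrow> C * 0"
    by (intro tendsto_mult_left slow_relative_decay y)
  then have lim: "(\<lambda>n. C * (norm (mat_prod a n *v y) / E n)) \<longlonglongrightarrow> 0" by simp
  have "\<forall>\<^sub>F n in sequentially. norm (u n \<bullet> y) \<le> C * (norm (mat_prod a n *v y) / E n)"
    using C
  proof eventually_elim
    case (elim n)
    then have "E n * \<bar>u n \<bullet> y\<bar> \<le> C * norm (mat_prod a n *v y)" by blast
    then show ?case using E_pos[of n] by (simp add: field_simps)
  qed
  from Lim_null_comparison[OF this lim] show ?thesis .
qed

lemma top_right_directions_column_sums:
  "top_right_directions (\<lambda>n. column_sums (mat_prod a n) /\<^sub>R norm (column_sums (mat_prod a n)))"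
  unfolding top_right_directions_def
proof (intro conjI always_eventually allI exI)
  fix n i
  let ?p = "real CARD('p)" and ?r = "column_sums (mat_prod a n)"
  have Er: "E n \<le> ?p * norm ?r" by (rule entry_sum_le_norm_column_sums)
  then have r: "0 < norm ?r" using E_pos[of n] by (cases "?r = 0") auto
  then show "norm (?r /\<^sub>R norm ?r) = 1" by simp
  have "0 \<le> ?r $ i" using nonneg_prod[of n] by (auto simp: column_sums_def nonneg_matrix_def intro!: sum_nonneg)
  then show "0 \<le> (?r /\<^sub>R norm ?r) $ i" by simp
  fix y
  have "E n * \<bar>(?r /\<^sub>R norm ?r) \<bullet> y\<bar> = (E n / norm ?r) * \<bar>?r \<bullet> y\<bar>"
    by (simp add: abs_mult field_simps)
  also have "\<dots> \<le> ?p * \<bar>?r \<bullet> y\<bar>"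
    using Er r by (intro mult_right_mono) (auto simp: field_simps)
  also have "\<dots> \<le> ?p * (?p * norm (mat_prod a n *v y))"
    by (intro mult_left_mono abs_inner_column_sums_le) auto
  finally show "E n * \<bar>(?r /\<^sub>R norm ?r) \<bullet> y\<bar> \<le> ?p * ?p * norm (mat_prod a n *v y)"
    by (simp add: mult.assoc)
qed

text \<open>The normalized column sums show that the slow hyperplane has a nonnegative unit normal.
  Every other sequence of top right directions is then forced to the same limit, so the convergence
  of the singular vectors is derived here.\<close>

lemma normal_direction:
  obtains v where "norm v = 1" "\<And>i. 0 \<le> v $ i" "lyap_space a l2 = {y. v \<bullet> y = 0}"
    "\<And>u. top_right_directions u \<Longrightarrow> u \<longlonglongrightarrow> v"
proof -
  let ?u = "\<lambda>n. column_sums (mat_prod a n) /\<^sub>R norm (column_sums (mat_prod a n))"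
  obtain v where v: "norm v = 1" "\<And>i. 0 \<le> v $ i" "lyap_space a l2 = {y. v \<bullet> y = 0}"
  proof (rule nonneg_unit_normal_exists[OF subspace_lyap_space[of a l2] dim_slow, of ?u])
    show "\<forall>\<^sub>F n in sequentially. norm (?u n) = 1 \<and> (\<forall>i. 0 \<le> ?u n $ i)"
      using top_right_directions_column_sums unfolding top_right_directions_def by blast
    show "(\<lambda>n. ?u n \<bullet> y) \<longlonglongrightarrow> 0" if "y \<in> lyap_space a l2" for y
      by (rule top_right_directions_tendsto_0[OF top_right_directions_column_sums that])
  qed blast
  have "norm v \<le> (\<Sum>i\<in>UNIV. v $ i)" using norm_le_l1_cart[of v] v(2) by simp
  then have s: "0 < (\<Sum>i\<in>UNIV. v $ i)" using v(1) by simp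
  have "u \<longlonglongrightarrow> v" if "top_right_directions u" for u
  proof (rule tendsto_unit_normal[OF v(1) s])
    show "\<forall>\<^sub>F n in sequentially. norm (u n) = 1 \<and> (\<forall>i. 0 \<le> u n $ i)"
      using that unfolding top_right_directions_def by blast
    show "(\<lambda>n. u n \<bullet> y) \<longlonglongrightarrow> 0" if "v \<bullet> y = 0" for y
      using top_right_directions_tendsto_0[OF \<open>top_right_directions u\<close>] v(3) that by blast
  qed
  then show thesis by (rule that[OF v])
qed

text \<open>For z orthogonal to v the coordinates of z are also its coefficients in the projected
  unit vectors, so the exponent of z cannot exceed their maximum. This expresses \<lambda>_2 through
  v by finitely many measurable operations.\<close>

lemma l2_eq_Max:
  assumes v: "norm v = 1" "lyap_space a l2 = {y. v \<bullet> y = 0}"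
  shows "l2 = Max (range (\<lambda>i. lyap a (axis i 1 - (v $ i) *\<^sub>R v)))"
proof -
  let ?e = "\<lambda>i. axis i 1 - (v $ i) *\<^sub>R v"
  let ?m = "Max (range (\<lambda>i. lyap a (?e i)))"
  have "v \<bullet> v = 1" using v by (simp add: norm_eq_1)
  then have "?e i \<in> lyap_space a l2" for i
    unfolding v(2) by (simp add: inner_diff_right inner_axis)
  then have le: "?m \<le> l2" by (subst Max_le_iff) (auto simp: lyap_space_def)
  obtain z where z: "lyap a z = l2" using l2_attained by blast
  then have "z \<in> lyap_space a l2" by (simp add: lyap_space_def)
  then have vz: "v \<bullet> z = 0" using v(2) by blast
  have "z = (\<Sum>i\<in>UNIV. z $ i *\<^sub>R ?e i)"
  proof -
    have "(\<Sum>i\<in>UNIV. z $ i *\<^sub>R ?e i) = (\<Sum>i\<in>UNIV. z $ i *\<^sub>R axis i 1) - (\<Sum>i\<in>UNIV. z $ i * v $ i) *\<^sub>R v"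
      by (simp add: scaleR_diff_right sum_subtractf scaleR_sum_left)
    also have "(\<Sum>i\<in>UNIV. z $ i * v $ i) = 0" using vz by (simp add: inner_vec_def mult.commute)
    also have "(\<Sum>i\<in>UNIV. z $ i *\<^sub>R axis i 1) = z"
      using basis_expansion[of z] by (simp add: scalar_mult_eq_scaleR)
    finally show ?thesis by simp
  qed
  moreover have "?e i \<in> lyap_space a ?m" for i unfolding lyap_space_def by simp
  then have "(\<Sum>i\<in>UNIV. z $ i *\<^sub>R ?e i) \<in> lyap_space a ?m"
    by (intro subspace_sum subspace_scale subspace_lyap_space)
  ultimately have "z \<in> lyap_space a ?m" by simp
  then show ?thesis using z le by (simp add: lyap_space_def)
qed

text \<open>Some z in the hyperplane attains l2 and lies outside a subspace L containing all vectors
  slower than l2; c is the component of z orthogonal to L. Then c \<bullet> z \<noteq> 0 = v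
  \<bullet> z, so pairing the combination in the second claim with z gives (v \<bullet> w) (c
  \<bullet> z) \<noteq> 0.\<close>

lemma exceptional_functional:
  assumes v: "norm v = 1" "lyap_space a l2 = {y. v \<bullet> y = 0}"
  obtains c where "\<And>y. lyap a y < l2 \<Longrightarrow> c \<bullet> y = 0"
    "\<And>w. v \<bullet> w \<noteq> 0 \<Longrightarrow> (v \<bullet> w) *\<^sub>R c - (c \<bullet> w) *\<^sub>R v \<noteq> 0"
proof -
  obtain z where z: "z \<noteq> 0" "lyap a z = l2" using l2_attained by blast
  then have "z \<in> lyap_space a l2" by (simp add: lyap_space_def)
  then have vz: "v \<bullet> z = 0" using v(2) by blast
  obtain m where m: "\<And>y. lyap a y < l2 \<Longrightarrow> y \<in> lyap_space a m" "z \<notin> lyap_space a m \<or> l2 = -\<infinity>"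
  proof (cases "l2 = -\<infinity>")
    case False
    define S where "S = {\<mu> \<in> lyap a ` (UNIV - {0}). \<mu> < l2}"
    \<comment> \<open>Inserting -\<infinity> keeps the maximum meaningful when no nonzero vector is
      slower than l2.\<close>
    have fin: "finite (insert (-\<infinity>) S)" using finite_lyap_values[of a] by (simp add: S_def)
    define m where "m = Max (insert (-\<infinity>) S)"
    have "m \<in> insert (-\<infinity>) S" unfolding m_def using fin by (intro Max_in) auto
    then have "m < l2" using False by (auto simp: S_def)
    moreover have "y \<in> lyap_space a m" if "lyap a y < l2" for y
    proof (cases "y = 0")
      case True
      then show ?thesis by (simp add: lyap_space_def)
    next
      case False
      then have "lyap a y \<in> insert (-\<infinity>) S" using that by (auto simp: S_def)
      then show ?thesis unfolding m_def lyap_space_def using fin Max_ge by blast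
    qed
    ultimately show ?thesis using that[of m] z by (auto simp: lyap_space_def)
  qed (use that[of l2] in auto)
  define L where "L = (if l2 = -\<infinity> then {0} else lyap_space a m)"
  have L: "subspace L" "z \<notin> L" "\<And>y. lyap a y < l2 \<Longrightarrow> y \<in> L"
  proof -
    show "subspace L" by (simp add: L_def subspace_lyap_space)
    show "z \<notin> L" using m(2) z(1) by (auto simp: L_def)
    show "y \<in> L" if "lyap a y < l2" for y using m(1)[OF that] that by (auto simp: L_def)
  qed
  obtain x c where xc: "x \<in> span L" "\<And>w. w \<in> span L \<Longrightarrow> orthogonal c w" "z = x + c"
    by (rule orthogonal_subspace_decomp_exists[of L z]) blast
  have x: "x \<in> L" using xc(1) L(1) span_eq_iff by blast
  have c: "c \<noteq> 0"
  proof
    assume "c = 0"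
    then have "z = x" using xc(3) by simp
    then show False using x L(2) by simp
  qed
  have cL: "c \<bullet> y = 0" if "y \<in> L" for y
    using xc(2)[of y] that span_base by (auto simp: orthogonal_def)
  have "c \<bullet> z = c \<bullet> c" using cL[OF x] by (simp add: xc(3) inner_add_right)
  then have cz: "c \<bullet> z \<noteq> 0" using c by simp
  show thesis
  proof
    show "c \<bullet> y = 0" if "lyap a y < l2" for y using cL L(3)[OF that] by blast
    show "(v \<bullet> w) *\<^sub>R c - (c \<bullet> w) *\<^sub>R v \<noteq> 0" if "v \<bullet> w \<noteq> 0" for w
    proof
      assume "(v \<bullet> w) *\<^sub>R c - (c \<bullet> w) *\<^sub>R v = 0"
      then have "((v \<bullet> w) *\<^sub>R c - (c \<bullet> w) *\<^sub>R v) \<bullet> z = 0" by simp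
      then show False using that cz vz by (simp add: inner_diff_left)
    qed
  qed
qed

text \<open>The product E n * D n is pinched: it is at least |M_n y| / K, as no row sum exceeds E n,
  and at most K' exp(e n) |M_n y| by \<open>rows\<close> and \<open>ratios\<close>. The first bound
  with \<open>E_upper\<close> gives the lower estimate of the rate, the second with
  \<open>E_lower\<close> the upper one.\<close>

lemma limsup_ratio_error:
  fixes x w v :: "real^'p"
  defines "y \<equiv> (v \<bullet> w) *\<^sub>R x - (v \<bullet> x) *\<^sub>R w"
  defines "D \<equiv> \<lambda>n. Max ((\<lambda>i. \<bar>(row i (mat_prod a n) \<bullet> x) / (row i (mat_prod a n) \<bullet> w) - (v \<bullet> x) / (v \<bullet> w)\<bar>)
       ` {i. row i (mat_prod a n) \<noteq> 0})"
  assumes rows: "\<forall>\<^sub>F n in sequentially. \<forall>i. row i (mat_prod a n) \<noteq> 0 \<longrightarrow> (\<forall>k. 0 < mat_prod a n $ i $ k)"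
    and ratios: "\<And>e. 0 < e \<Longrightarrow> \<forall>\<^sub>F n in sequentially. \<forall>i j k. 
       mat_prod a n $ j $ k \<noteq> 0 \<longrightarrow> mat_prod a n $ i $ k \<le> exp (e * real n) * mat_prod a n $ j $ k"
    and vw: "0 < v \<bullet> w" and w: "\<And>i. 0 < w $ i" and y: "lyap a y = l2"
  shows "limsup (\<lambda>n. elog (D n) / ereal (real n)) = - (ereal l1 - l2)"
proof -
  let ?M = "mat_prod a"
  let ?p = "real CARD('p)"
  let ?f = "\<lambda>n i. \<bar>(row i (?M n) \<bullet> x) / (row i (?M n) \<bullet> w) - (v \<bullet> x) / (v \<bullet> w)\<bar>"
  have Mpos: "0 \<le> ?M n $ i $ k" for n i k using nonneg_prod[of n] by (simp add: nonneg_matrix_def)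
  have row_w: "row i (?M n) \<bullet> w = (\<Sum>k\<in>UNIV. ?M n $ i $ k * w $ k)" for i n
    by (simp add: row_def inner_vec_def)
  have row_y: "row i (?M n) \<bullet> y = (?M n *v y) $ i" for i n
    by (simp add: row_def inner_vec_def matrix_vector_mult_def)
  have rw_pos: "0 < row i (?M n) \<bullet> w" if r: "row i (?M n) \<noteq> 0" for i n
  proof -
    obtain k where "row i (?M n) $ k \<noteq> 0" using r by (metis vec_eq_iff zero_index)
    then have "?M n $ i $ k \<noteq> 0" by (simp add: row_def)
    then have "0 < ?M n $ i $ k * w $ k" using w[of k] Mpos[of n i k] by (simp add: less_le)
    also have "\<dots> \<le> row i (?M n) \<bullet> w"
      unfolding row_w by (rule member_le_sum) (auto intro!: mult_nonneg_nonneg Mpos less_imp_le[OF w])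
    finally show ?thesis .
  qed
  have f_eq: "?f n i = \<bar>(?M n *v y) $ i\<bar> / ((row i (?M n) \<bullet> w) * (v \<bullet> w))" if "row i (?M n) \<noteq> 0" for i n
  proof -
    have "(row i (?M n) \<bullet> x) / (row i (?M n) \<bullet> w) - (v \<bullet> x) / (v \<bullet> w) =
        (row i (?M n) \<bullet> y) / ((row i (?M n) \<bullet> w) * (v \<bullet> w))"
      using rw_pos[OF that] vw by (simp add: y_def inner_diff_right field_simps)
    then show ?thesis using rw_pos[OF that] vw by (simp add: row_y abs_mult)
  qed
  have rw_le: "row i (?M n) \<bullet> w \<le> E n * norm w" for i n
  proof -
    have "row i (?M n) \<bullet> w \<le> (\<Sum>k\<in>UNIV. ?M n $ i $ k * norm w)"
      unfolding row_w using component_le_norm_cart[of w] Mpos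
      by (intro sum_mono mult_left_mono) (auto simp: abs_le_iff)
    also have "\<dots> = (\<Sum>k\<in>UNIV. ?M n $ i $ k) * norm w" by (simp add: sum_distrib_right)
    also have "\<dots> \<le> E n * norm w"
      by (intro mult_right_mono row_sum_le_entry_sum nonneg_prod) auto
    finally show ?thesis .
  qed
  \<comment> \<open>Without this, \<open>Max\<close> would be unspecified; column-allowability of
    the product provides a nonzero row.\<close>
  have nonempty: "{i. row i (?M n) \<noteq> 0} \<noteq> {}" for n
  proof
    assume "{i. row i (?M n) \<noteq> 0} = {}"
    then have "E n = 0" by (auto simp: entry_sum_def row_def vec_eq_iff)
    then show False using E_pos[of n] by simp
  qed
  have D_ge: "?f n i \<le> D n" if "row i (?M n) \<noteq> 0" for i n
    unfolding D_def using that by (intro Max_ge) auto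
  have D_nonneg: "0 \<le> D n" for n using nonempty[of n] D_ge[of _ n] by (force intro: order_trans[OF abs_ge_zero])
  define K where "K = ?p * (norm w * (v \<bullet> w))"
  have y_le: "norm (?M n *v y) \<le> K * E n * D n" for n
  proof -
    have "norm (?M n *v y) \<le> (\<Sum>i\<in>UNIV. \<bar>(?M n *v y) $ i\<bar>)" by (rule norm_le_l1_cart)
    also have "\<dots> \<le> (\<Sum>i::'p\<in>UNIV. E n * norm w * (v \<bullet> w) * D n)"
    proof (rule sum_mono)
      fix i
      show "\<bar>(?M n *v y) $ i\<bar> \<le> E n * norm w * (v \<bullet> w) * D n"
      proof (cases "row i (?M n) = 0")
        case True
        then show ?thesis using row_y[of i n] E_pos[of n] vw D_nonneg[of n] by (simp add: less_imp_le)
      next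
        case False
        have "\<bar>(?M n *v y) $ i\<bar> = (row i (?M n) \<bullet> w) * (v \<bullet> w) * ?f n i"
          unfolding f_eq[OF False] using rw_pos[OF False] vw by simp
        also have "\<dots> \<le> E n * norm w * (v \<bullet> w) * D n"
          using rw_le[of i n] D_ge[OF False] vw rw_pos[OF False] E_pos[of n]
          by (intro mult_mono) (auto intro!: mult_nonneg_nonneg less_imp_le)
        finally show ?thesis .
      qed
    qed
    also have "\<dots> = K * E n * D n" by (simp add: K_def)
    finally show ?thesis .
  qed
  define wm where "wm = Min (range (\<lambda>i. w $ i))"
  have wm: "0 < wm" "\<And>i. wm \<le> w $ i" using w unfolding wm_def by auto
  define K' where "K' = ?p / (wm * (v \<bullet> w))"
  have D_le: "\<forall>\<^sub>F n in sequentially. E n * D n \<le> K' * exp (e * real n) * norm (?M n *v y)" if "0 < e" for e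
    using ratios[OF that] rows
  proof eventually_elim
    case (elim n)
    have "D n \<in> ?f n ` {i. row i (?M n) \<noteq> 0}"
      unfolding D_def using nonempty[of n] by (intro Max_in) auto
    then obtain i where i: "row i (?M n) \<noteq> 0" "D n = ?f n i" by auto
    \<comment> \<open>Row i is strictly positive, so in every column k its entry is an admissible
      denominator and dominates all entries of that column up to exp(e n).\<close>
    have "E n \<le> (\<Sum>j::'p\<in>UNIV. \<Sum>k\<in>UNIV. exp (e * real n) * ?M n $ i $ k)"
      unfolding entry_sum_def using elim i(1) by (intro sum_mono) (metis less_irrefl)
    also have "\<dots> = ?p * exp (e * real n) * (\<Sum>k\<in>UNIV. ?M n $ i $ k)"
      by (simp add: sum_distrib_left mult.assoc)
    finally have E1: "E n \<le> ?p * exp (e * real n) * (\<Sum>k\<in>UNIV. ?M n $ i $ k)" .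
    have "wm * (\<Sum>k\<in>UNIV. ?M n $ i $ k) \<le> row i (?M n) \<bullet> w"
      unfolding row_w sum_distrib_left
      by (rule sum_mono) (subst mult.commute, rule mult_left_mono[OF wm(2) Mpos])
    then have "(\<Sum>k\<in>UNIV. ?M n $ i $ k) \<le> (row i (?M n) \<bullet> w) / wm" using wm(1) by (simp add: field_simps)
    then have "?p * exp (e * real n) * (\<Sum>k\<in>UNIV. ?M n $ i $ k) \<le> ?p * exp (e * real n) * ((row i (?M n) \<bullet> w) / wm)"
      by (intro mult_left_mono) auto
    with E1 have "E n \<le> ?p * exp (e * real n) * ((row i (?M n) \<bullet> w) / wm)" by linarith
    then have "E n * D n \<le> ?p * exp (e * real n) * ((row i (?M n) \<bullet> w) / wm) * D n"
      by (intro mult_right_mono D_nonneg)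
    also have "\<dots> = K' * exp (e * real n) * \<bar>(?M n *v y) $ i\<bar>"
      unfolding i(2) f_eq[OF i(1)] K'_def using rw_pos[OF i(1)] vw wm(1) by simp
    also have "\<dots> \<le> K' * exp (e * real n) * norm (?M n *v y)"
      using vw wm(1) by (intro mult_left_mono component_le_norm_cart) (auto simp: K'_def)
    finally show ?case .
  qed
  let ?G = "limsup (\<lambda>n. elog (D n) / ereal (real n))"
  have "?G \<le> l2 - ereal l1"
    unfolding limsup_elog_le_iff
  proof (intro allI impI)
    fix d assume "l2 - ereal l1 < ereal d"
    then have "l2 < ereal (d + l1)" by (cases l2) auto
    then obtain d' where d': "l2 < ereal d'" "d' < d + l1" using ereal_real_dense by blast
    \<comment> \<open>Two losses of e occur, in \<open>ratios\<close> and in \<open>E_lower\<close>;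
      the resulting exponent is d - e, and the last e absorbs the constant K'.\<close>
    define e where "e = (d + l1 - d') / 3"
    have e: "0 < e" using d' by (simp add: e_def)
    have "\<forall>\<^sub>F n in sequentially. norm (?M n *v y) \<le> exp (d' * real n)"
      using y d'(1) lyap_le_iff[of a y l2] by auto
    moreover have "\<forall>\<^sub>F n in sequentially. exp ((l1 - e) * real n) \<le> E n"
      by (rule E_lower) (use e in auto)
    moreover have "\<forall>\<^sub>F n in sequentially. K' * exp ((e + d' - (l1 - e)) * real n) \<le> exp (d * real n)"
      by (rule eventually_const_mult_exp_le) (use e in \<open>simp add: e_def field_simps\<close>)
    ultimately show "\<forall>\<^sub>F n in sequentially. D n \<le> exp (d * real n)"
      using D_le[OF e]
    proof eventually_elim
      case (elim n)
      have K': "0 \<le> K'" using vw wm(1) by (simp add: K'_def)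
      have "exp ((l1 - e) * real n) * D n \<le> E n * D n"
        using elim D_nonneg[of n] by (intro mult_right_mono) auto
      also have "\<dots> \<le> K' * exp (e * real n) * norm (?M n *v y)" by (rule elim)
      also have "\<dots> \<le> K' * exp (e * real n) * exp (d' * real n)"
        using elim K' by (intro mult_left_mono) auto
      also have "\<dots> = exp ((l1 - e) * real n) * (K' * exp ((e + d' - (l1 - e)) * real n))"
        by (simp add: mult_exp_exp algebra_simps)
      also have "\<dots> \<le> exp ((l1 - e) * real n) * exp (d * real n)"
        using elim by (intro mult_left_mono) auto
      finally show ?case by simp
    qed
  qed
  moreover have "l2 \<le> ?G + ereal l1"
  proof -
    have "lyap a y \<le> ?G + ereal l1"
      unfolding lyap_le_iff
    proof (intro allI impI)
      fix d assume "?G + ereal l1 < ereal d"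
      then have "?G < ereal (d - l1)" by (cases ?G) auto
      then obtain d' where d': "?G < ereal d'" "d' < d - l1" using ereal_real_dense by blast
      \<comment> \<open>One e is lost in \<open>E_upper\<close>, so the exponent is d - e, and the
        other absorbs K.\<close>
      define e where "e = (d - l1 - d') / 2"
      have e: "0 < e" using d' by (simp add: e_def)
      have "\<forall>\<^sub>F n in sequentially. D n \<le> exp (d' * real n)"
        using d'(1) limsup_elog_le_iff[of D ?G] by auto
      moreover have "\<forall>\<^sub>F n in sequentially. E n \<le> exp ((l1 + e) * real n)"
        by (rule E_upper) (use e in auto)
      moreover have "\<forall>\<^sub>F n in sequentially. K * exp ((l1 + e + d') * real n) \<le> exp (d * real n)"
        by (rule eventually_const_mult_exp_le) (use e in \<open>simp add: e_def field_simps\<close>)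
      ultimately show "\<forall>\<^sub>F n in sequentially. norm (?M n *v y) \<le> exp (d * real n)"
      proof eventually_elim
        case (elim n)
        have K: "0 \<le> K" using vw by (simp add: K_def)
        have "norm (?M n *v y) \<le> K * E n * D n" by (rule y_le)
        also have "\<dots> \<le> K * exp ((l1 + e) * real n) * exp (d' * real n)"
          using elim K E_pos[of n] D_nonneg[of n] by (intro mult_mono) auto
        also have "\<dots> = K * exp ((l1 + e + d') * real n)"
          by (simp add: mult_exp_exp algebra_simps)
        finally show ?case using elim by linarith
      qed
    qed
    then show ?thesis using y by simp
  qed
  then have "l2 - ereal l1 \<le> ?G" by (cases ?G; cases l2) auto
  ultimately have "?G = l2 - ereal l1" by (rule antisym)
  \<comment> \<open>For l2 = -\<infinity> both sides are -\<infinity>: the error then decays faster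
    than every exponential.\<close>
  then show ?thesis by (cases l2) auto
qed

end

text \<open>The growth rate of the entry sums is the top exponent: it bounds every exponent by |M x|
  \<le> E |x|, and is itself bounded by the exponent of the all-ones vector. It is real because the
  gap excludes -\<infinity> and \<open>fin\<close> excludes \<infinity>.\<close>

lemma dominated_products_of_gap:
  fixes a :: "nat \<Rightarrow> real^'p^'p"
  assumes card: "CARD('p) \<ge> 2"
    and gap: "lyapunov_exponent a 2 < lyapunov_exponent a 1"
    and pos: "\<And>n. n \<ge> 1 \<Longrightarrow> nonneg_matrix (a n) \<and> column_allowable (a n)"
    and lims: "limsup (\<lambda>n. ereal (ln (entry_sum (mat_prod a n)) / real n))
        \<le> liminf (\<lambda>n. ereal (ln (entry_sum (mat_prod a n)) / real n))"
    and fin: "limsup (\<lambda>n. ereal (ln (entry_sum (mat_prod a n)) / real n)) < \<infinity>"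
  obtains l1 where "lyapunov_exponent a 1 = ereal l1"
    "dominated_products a l1 (lyapunov_exponent a 2)"
proof -
  let ?E = "\<lambda>n. entry_sum (mat_prod a n)"
  let ?p = "real CARD('p)"
  let ?u = "\<lambda>n. ereal (ln (?E n) / real n)"
  note flag = spectral_gap_flag[OF card gap]
  have nonneg: "nonneg_matrix (mat_prod a n)" for n
    by (rule nonneg_mat_prod) (simp add: pos)
  have allow: "column_allowable (mat_prod a n)" for n
    by (rule column_allowable_mat_prod) (simp_all add: pos)
  have E_pos: "0 < ?E n" for n using entry_sum_pos[OF nonneg allow] .
  have u_eq: "limsup ?u = limsup (\<lambda>n. elog (?E n) / ereal (real n))"
  proof (rule Limsup_eq)
    show "\<forall>\<^sub>F n in sequentially. ?u n = elog (?E n) / ereal (real n)"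
      using eventually_gt_at_top[of "0::nat"]
    proof eventually_elim
      case (elim n)
      then show ?case using E_pos[of n] by (simp add: elog_def)
    qed
  qed
  have E_up: "\<forall>\<^sub>F n in sequentially. ?E n \<le> exp (d * real n)" if "limsup ?u < ereal d" for d
  proof -
    have "limsup (\<lambda>n. elog (?E n) / ereal (real n)) \<le> limsup ?u"
      by (rule eq_refl[OF u_eq[symmetric]])
    then have "\<forall>d. limsup ?u < ereal d \<longrightarrow> (\<forall>\<^sub>F n in sequentially. ?E n \<le> exp (d * real n))"
      by (rule limsup_elog_le_iff[THEN iffD1])
    then show ?thesis using that by (elim allE impE) 
  qed
  have "lyap a x \<le> limsup ?u" for x
    unfolding lyap_le_iff
  proof (intro allI impI)
    fix d assume "limsup ?u < ereal d"
    then obtain d' where d': "limsup ?u < ereal d'" "d' < d" using ereal_real_dense by blast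
    have "\<forall>\<^sub>F n in sequentially. ?E n \<le> exp (d' * real n)"
      by (rule E_up[OF d'(1)])
    with eventually_const_mult_exp_le[OF d'(2), of "norm x"]
    show "\<forall>\<^sub>F n in sequentially. norm (mat_prod a n *v x) \<le> exp (d * real n)"
    proof eventually_elim
      case (elim n)
      have "norm (mat_prod a n *v x) \<le> ?E n * norm x" by (rule norm_mult_vec_le_entry_sum[OF nonneg])
      also have "\<dots> \<le> exp (d' * real n) * norm x" using elim by (intro mult_right_mono) auto
      finally show ?case using elim by (simp add: mult.commute)
    qed
  qed
  note lyap_le = this
  obtain x where x: "lyap a x = lyapunov_exponent a 1" using flag(2) by blast
  have l1_le: "lyapunov_exponent a 1 \<le> limsup ?u" using lyap_le[of x] unfolding x .
  have "limsup ?u \<le> lyap a 1"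
    unfolding u_eq limsup_elog_le_iff
  proof (intro allI impI)
    fix d assume "lyap a 1 < ereal d"
    then obtain d' where d': "lyap a 1 < ereal d'" "d' < d" using ereal_real_dense by blast
    have "\<forall>\<^sub>F n in sequentially. norm (mat_prod a n *v 1) \<le> exp (d' * real n)"
      using d'(1) lyap_le_iff[of a 1 "lyap a 1"] by auto
    with eventually_const_mult_exp_le[OF d'(2), of ?p]
    show "\<forall>\<^sub>F n in sequentially. ?E n \<le> exp (d * real n)"
    proof eventually_elim
      case (elim n)
      have "?E n \<le> ?p * norm (mat_prod a n *v 1)" by (rule entry_sum_le_norm_mult_1)
      also have "\<dots> \<le> ?p * exp (d' * real n)" using elim by (intro mult_left_mono) auto
      finally show ?case using elim by linarith
    qed
  qed
  from order_trans[OF this flag(1)] have l1: "lyapunov_exponent a 1 = limsup ?u"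
    using l1_le by (rule antisym[rotated])
  have "limsup ?u \<noteq> -\<infinity>" using gap l1 by auto
  then obtain l where l: "limsup ?u = ereal l" using fin by (cases "limsup ?u") auto
  have "?u \<longlonglongrightarrow> ereal l"
  proof (rule tendsto_iff_Liminf_eq_Limsup[THEN iffD2, rotated])
    show "liminf ?u = ereal l \<and> limsup ?u = ereal l"
      using antisym[OF Liminf_le_Limsup[OF trivial_limit_sequentially, of ?u] lims] l by (simp only: simp_thms)
  qed (rule trivial_limit_sequentially)
  then have growth: "(\<lambda>n. ln (?E n) / real n) \<longlonglongrightarrow> l" by (simp only: lim_ereal)
  show thesis
  proof (rule that[of l])
    show "lyapunov_exponent a 1 = ereal l" using l1 l by simp
    show "dominated_products a l (lyapunov_exponent a 2)"
    proof
      show "lyapunov_exponent a 2 < ereal l" using gap l1 l by simp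
      show "\<exists>z. z \<noteq> 0 \<and> lyap a z = lyapunov_exponent a 2" by (rule flag(5))
    qed (use pos growth flag(4) in simp_all)
  qed
qed

section \<open>Measurability and genericity\<close>

lemma borel_measurable_vec_component [measurable (raw)]:
  fixes f :: "'b \<Rightarrow> 'c::{second_countable_topology,real_normed_vector}^'n"
  assumes "f \<in> borel_measurable N"
  shows "(\<lambda>x. f x $ i) \<in> borel_measurable N"
  using measurable_compose[OF assms borel_measurable_continuous_onI[of "\<lambda>v. v $ i"]]
  by (simp add: continuous_on_component)

lemma borel_measurable_vec_iff_components:
  fixes f :: "'b \<Rightarrow> real^'n"
  assumes "\<And>i. (\<lambda>x. f x $ i) \<in> borel_measurable N"
  shows "f \<in> borel_measurable N"
  unfolding borel_measurable_euclidean_space[of f]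
  using assms by (auto simp: Basis_vec_def inner_axis)

lemma borel_measurable_mat_prod_component:
  fixes A :: "nat \<Rightarrow> 'b \<Rightarrow> real^'n^'n"
  assumes "\<And>n. n \<ge> 1 \<Longrightarrow> A n \<in> borel_measurable N"
  shows "(\<lambda>x. mat_prod (\<lambda>m. A m x) n $ i $ k) \<in> borel_measurable N"
proof (induction n arbitrary: i)
  case (Suc n)
  have [measurable]: "A (Suc n) \<in> borel_measurable N" using assms by simp
  note Suc [measurable]
  show ?case by (simp add: matrix_matrix_mult_def)
qed simp

lemma borel_measurable_elog [measurable]: "elog \<in> borel_measurable borel"
  unfolding elog_def[abs_def] by measurable

lemma borel_measurable_lyap:
  fixes A :: "nat \<Rightarrow> 'b \<Rightarrow> real^'n^'n"
  assumes "\<And>n. n \<ge> 1 \<Longrightarrow> A n \<in> borel_measurable N" and [measurable]: "y \<in> borel_measurable N"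
  shows "(\<lambda>x. lyap (\<lambda>m. A m x) (y x)) \<in> borel_measurable N"
proof -
  note borel_measurable_mat_prod_component[OF assms(1), measurable]
  have [measurable]: "(\<lambda>x. mat_prod (\<lambda>m. A m x) n *v y x) \<in> borel_measurable N" for n
    by (rule borel_measurable_vec_iff_components) (simp add: matrix_vector_mult_def)
  show ?thesis unfolding lyap_def by measurable
qed

lemma mat_prod_cong: "(\<And>k. 1 \<le> k \<Longrightarrow> k \<le> n \<Longrightarrow> a k = b k) \<Longrightarrow> mat_prod a n = mat_prod b n"
  by (induction n) auto

lemma mat_prod_add: "mat_prod a (l + m) = mat_prod (\<lambda>k. a (k + l)) m ** mat_prod a l"
  by (induction m) (auto simp: matrix_mul_assoc[symmetric] add.commute)

text \<open>The Furstenberg-Kesten theorem. The original space carries no transformation;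
  stationarity says that the shift preserves the law on sequence space, so Kingman's theorem is
  applied there and the conclusion is pulled back along X.\<close>

lemma AE_ln_entry_sum_limit:
  fixes A :: "nat \<Rightarrow> 'a \<Rightarrow> real^'p^'p"
  assumes prob: "prob_space P"
    and random: "\<And>n. n \<ge> 1 \<Longrightarrow> A n \<in> borel_measurable P"
    and nonneg: "AE \<omega> in P. \<forall>n\<ge>1. nonneg_matrix (A n \<omega>) \<and> column_allowable (A n \<omega>)"
    and stationary: "strictly_stationary P A"
    and log_moment: "integrable P (\<lambda>\<omega>. ln (max 1 (norm (A 1 \<omega>))))"
  defines "u \<equiv> \<lambda>\<omega> n. ereal (ln (entry_sum (mat_prod (\<lambda>m. A m \<omega>) n)) / real n)"
  shows "AE \<omega> in P. limsup (u \<omega>) \<le> liminf (u \<omega>) \<and> limsup (u \<omega>) < \<infinity>"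
proof -
  interpret P: prob_space P by (rule prob)
  let ?S = "\<Pi>\<^sub>M n\<in>(UNIV :: nat set). borel :: (real^'p^'p) measure"
  define X where "X = (\<lambda>\<omega> n. A (Suc n) \<omega>)"
  define \<nu> where "\<nu> = process_law P A"
  define T where "T = (\<lambda>s n. s (Suc n) :: real^'p^'p)"
  \<comment> \<open>Sequences start at index 0 while \<open>mat_prod\<close> reads its factors from
    index 1 on.\<close>
  define g where "g = (\<lambda>n s. ln (entry_sum (mat_prod (\<lambda>m. s (m - 1) :: real^'p^'p) n)))"
  have X [measurable]: "X \<in> measurable P ?S"
    unfolding X_def by (rule measurable_PiM_single') (use random in auto)
  have \<nu>: "\<nu> = distr P ?S X" by (simp add: \<nu>_def process_law_def X_def)
  have [measurable_cong]: "sets \<nu> = sets ?S" by (simp add: \<nu>)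
  have T_S [measurable]: "T \<in> measurable ?S ?S"
    unfolding T_def by (rule measurable_PiM_single') auto
  have T [measurable]: "T \<in> measurable \<nu> \<nu>" by measurable
  have "distr \<nu> \<nu> T = distr \<nu> ?S T" by (rule distr_cong) (simp_all add: \<nu>)
  also have "\<dots> = distr P ?S (T \<circ> X)" unfolding \<nu> by (rule distr_distr) measurable
  also have "\<dots> = process_law P (\<lambda>n. A (n + 1))" by (simp add: process_law_def T_def X_def o_def)
  also have "\<dots> = \<nu>" unfolding \<nu>_def using stationary[unfolded strictly_stationary_def, rule_format, of 1] .
  finally have T_pres: "distr \<nu> \<nu> T = \<nu>" .
  have g_X: "g n (X \<omega>) = ln (entry_sum (mat_prod (\<lambda>m. A m \<omega>) n))" for n \<omega>
    unfolding g_def X_def by (subst mat_prod_cong[of n _ "\<lambda>m. A m \<omega>"]) auto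
  have g_m: "g n \<in> borel_measurable ?S" for n
  proof -
    have [measurable]: "(\<lambda>s. s (m - 1)) \<in> borel_measurable ?S" for m by measurable
    note borel_measurable_mat_prod_component[where A="\<lambda>m s. s (m - 1)" and N="?S", measurable]
    show ?thesis unfolding g_def entry_sum_def by measurable
  qed
  have pos: "AE s in \<nu>. \<forall>n. nonneg_matrix (s n) \<and> column_allowable (s n)"
  proof -
    have m: "{s \<in> space ?S. \<forall>n. nonneg_matrix (s n) \<and> column_allowable (s n)} \<in> sets ?S"
      unfolding nonneg_matrix_def column_allowable_def by measurable
    have "AE \<omega> in P. \<forall>n. nonneg_matrix (X \<omega> n) \<and> column_allowable (X \<omega> n)"
      using nonneg by eventually_elim (simp add: X_def)
    then show ?thesis unfolding \<nu> by (subst AE_distr_iff[OF X m])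
  qed
  have T_pow: "(T ^^ l) s = (\<lambda>n. s (n + l))" for l s
    by (induction l) (auto simp: T_def)
  have sub: "AE s in \<nu>. \<forall>l\<ge>1. \<forall>m\<ge>1. g (l + m) s \<le> g l s + g m ((T ^^ l) s)"
    using pos
  proof eventually_elim
    case (elim s)
    have pp: "nonneg_matrix (mat_prod (\<lambda>m. s (m - 1 + l)) n) \<and> column_allowable (mat_prod (\<lambda>m. s (m - 1 + l)) n)" for l n
      using elim by (intro conjI nonneg_mat_prod column_allowable_mat_prod) auto
    show ?case
    proof (intro allI impI)
      fix l m :: nat
      let ?B = "mat_prod (\<lambda>m. s (m - 1)) l" and ?C = "mat_prod (\<lambda>m. s (m - 1 + l)) m"
      have B: "nonneg_matrix ?B" "column_allowable ?B" using pp[of 0 l] by auto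
      have C: "nonneg_matrix ?C" "column_allowable ?C" using pp[of l m] by auto
      have "mat_prod (\<lambda>m. s (m - 1)) (l + m) = ?C ** ?B"
        unfolding mat_prod_add by (rule arg_cong2[where f="(**)", OF mat_prod_cong refl]) auto
      then have "g (l + m) s = ln (entry_sum (?C ** ?B))" by (simp add: g_def)
      \<comment> \<open>Monotonicity of the real logarithm needs positive entry sums, which
        column-allowability supplies.\<close>
      also have "\<dots> \<le> ln (entry_sum ?C * entry_sum ?B)"
        using entry_sum_mult_le[OF C(1) B(1)] entry_sum_pos[OF nonneg_matrix_mult[OF C(1) B(1)] column_allowable_mult[OF C(1) B(1) C(2) B(2)]]
        by simp
      also have "\<dots> = g m ((T ^^ l) s) + g l s"
        using entry_sum_pos[OF C] entry_sum_pos[OF B] by (simp add: g_def T_pow ln_mult)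
      finally show "g (l + m) s \<le> g l s + g m ((T ^^ l) s)" by simp
    qed
  qed
  have int: "integrable \<nu> (\<lambda>s. max 0 (g 1 s))"
  proof -
    let ?p = "real CARD('p)"
    have "integrable P (\<lambda>\<omega>. max 0 (g 1 (X \<omega>)))"
    proof (rule Bochner_Integration.integrable_bound)
      show "integrable P (\<lambda>\<omega>. ln (?p\<^sup>2) + ln (max 1 (norm (A 1 \<omega>))))" using log_moment by simp
      show "(\<lambda>\<omega>. max 0 (g 1 (X \<omega>))) \<in> borel_measurable P"
        using measurable_compose[OF X g_m[of 1]] by measurable
      show "AE \<omega> in P. norm (max 0 (g 1 (X \<omega>))) \<le> norm (ln (?p\<^sup>2) + ln (max 1 (norm (A 1 \<omega>))))"
        using nonneg
      proof eventually_elim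
        case (elim \<omega>)
        let ?B = "A 1 \<omega>"
        have B: "nonneg_matrix ?B" "column_allowable ?B" using elim by auto
        have p: "1 \<le> ?p" by (simp add: Suc_le_eq)
        have "entry_sum ?B \<le> (\<Sum>i::'p\<in>UNIV. \<Sum>j::'p\<in>UNIV. norm ?B)"
          unfolding entry_sum_def
        proof (intro sum_mono)
          fix i j
          have "?B $ i $ j \<le> norm (?B $ i)" using component_le_norm_cart[of "?B $ i" j] by simp
          also have "\<dots> \<le> norm ?B" by (rule Finite_Cartesian_Product.norm_nth_le)
          finally show "?B $ i $ j \<le> norm ?B" .
        qed
        also have "\<dots> = ?p\<^sup>2 * norm ?B" by (simp add: power2_eq_square)
        also have "\<dots> \<le> ?p\<^sup>2 * max 1 (norm ?B)" by (intro mult_left_mono) auto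
        finally have "ln (entry_sum ?B) \<le> ln (?p\<^sup>2 * max 1 (norm ?B))"
          using entry_sum_pos[OF B] by simp
        also have "\<dots> = ln (?p\<^sup>2) + ln (max 1 (norm ?B))" by (rule ln_mult_pos) auto
        finally have "g 1 (X \<omega>) \<le> ln (?p\<^sup>2) + ln (max 1 (norm ?B))"
          unfolding g_X by simp
        moreover have "0 \<le> ln (?p\<^sup>2)" "0 \<le> ln (max 1 (norm ?B))" using p by auto
        ultimately show ?case by simp
      qed
    qed
    moreover have "(\<lambda>s. max 0 (g 1 s)) \<in> borel_measurable ?S" using g_m[of 1] by measurable
    ultimately show ?thesis unfolding \<nu> by (subst integrable_distr_eq[OF X])
  qed
  interpret \<nu>: prob_space \<nu> unfolding \<nu> by (rule P.prob_space_distr[OF X])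
  interpret subadditive_cocycle \<nu> T g
  proof
    show "g n \<in> borel_measurable \<nu>" for n using g_m[of n] by measurable
  qed (fact T T_pres sub int)+
  have "AE s in distr P ?S X. limsup (\<lambda>n. ereal (g n s / real n)) \<le> liminf (\<lambda>n. ereal (g n s / real n)) \<and>
     limsup (\<lambda>n. ereal (g n s / real n)) < \<infinity>"
    using AE_limsup_le_liminf unfolding \<nu> .
  from AE_distrD[OF X this] show ?thesis unfolding g_X u_def .
qed

lemma AE_lborel_inner_neq_0:
  fixes d :: "'b::euclidean_space"
  assumes "d \<noteq> 0"
  shows "AE x in lborel. d \<bullet> x \<noteq> 0"
proof -
  have "{x. d \<bullet> x = 0} \<in> null_sets lebesgue"
    using negligible_hyperplane[of d 0] assms by (simp add: negligible_iff_null_sets)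
  then have "AE x in lebesgue. d \<bullet> x \<noteq> 0" by (rule AE_I') auto
  then show ?thesis by (simp add: AE_completion_iff)
qed

text \<open>For fixed x the expression is linear in w with coefficient vector, up to sign, (v
  \<bullet> x) c - (c \<bullet> x) v, which is nonzero when v \<bullet> x \<noteq> 0. So every
  section is off a hyperplane, and Fubini applies.\<close>

lemma AE_lborel_bilinear_neq_0:
  fixes v c :: "'b::euclidean_space"
  assumes "\<And>w. v \<bullet> w \<noteq> 0 \<Longrightarrow> (v \<bullet> w) *\<^sub>R c - (c \<bullet> w) *\<^sub>R v \<noteq> 0"
  shows "AE z in lborel. v \<bullet> fst z \<noteq> 0 \<longrightarrow> (v \<bullet> snd z) * (c \<bullet> fst z) - (v \<bullet> fst z) * (c \<bullet> snd z) \<noteq> 0"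
proof -
  let ?Q = "\<lambda>z. v \<bullet> fst z \<noteq> 0 \<longrightarrow> (v \<bullet> snd z) * (c \<bullet> fst z) - (v \<bullet> fst z) * (c \<bullet> snd z) \<noteq> 0"
  have "AE z in lborel \<Otimes>\<^sub>M (lborel :: 'b measure). ?Q z"
  proof (rule lborel_pair.AE_pair_measure)
    show "{z \<in> space (lborel \<Otimes>\<^sub>M lborel). ?Q z} \<in> sets (lborel \<Otimes>\<^sub>M (lborel :: 'b measure))"
      by measurable
    show "AE x in lborel. AE w in lborel. ?Q (x, w)"
    proof (rule AE_I2)
      fix x :: 'b
      show "AE w in lborel. ?Q (x, w)"
      proof (cases "v \<bullet> x = 0")
        case False
        from AE_lborel_inner_neq_0[OF assms[OF False]] show ?thesis
          by eventually_elim (auto simp: inner_diff_left mult.commute)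
      qed simp
    qed
  qed
  then show ?thesis unfolding lborel_prod .
qed

text \<open>The boundary of the orthant lies in coordinate hyperplanes. Strict positivity of w is
  what makes e_i M_n w comparable to the row sum.\<close>

lemma AE_lborel_nonneg_vectors_pos:
  "AE z in lborel :: ((real^'p) \<times> (real^'p)) measure. fst z \<in> nonneg_vectors \<and> snd z \<in> nonneg_vectors \<longrightarrow>
     (\<forall>i. 0 < fst z $ i) \<and> (\<forall>i. 0 < snd z $ i)"
proof -
  have "AE z in lborel :: ((real^'p) \<times> (real^'p)) measure. fst z $ i \<noteq> 0" for i
    using AE_lborel_inner_neq_0[of "(axis i 1, 0) :: (real^'p) \<times> (real^'p)"]
    by (simp add: inner_prod_def inner_axis' axis_eq_0_iff zero_prod_def)
  moreover have "AE z in lborel :: ((real^'p) \<times> (real^'p)) measure. snd z $ i \<noteq> 0" for i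
    using AE_lborel_inner_neq_0[of "(0, axis i 1) :: (real^'p) \<times> (real^'p)"]
    by (simp add: inner_prod_def inner_axis' axis_eq_0_iff zero_prod_def)
  ultimately have "AE z in lborel :: ((real^'p) \<times> (real^'p)) measure. (\<forall>i. fst z $ i \<noteq> 0) \<and> (\<forall>i. snd z $ i \<noteq> 0)"
    by (simp add: AE_all_countable)
  then show ?thesis
    by eventually_elim (auto simp: nonneg_vectors_def less_le)
qed

text \<open>Write M_n = C M_t. A nonzero row i of M_n must use, with a positive weight from C, some
  nonzero row of M_t; that row is strictly positive, and nothing can cancel it.\<close>

lemma eventually_rows_positive:
  fixes a :: "nat \<Rightarrow> real^'p^'p"
  assumes pos: "\<And>n. n \<ge> 1 \<Longrightarrow> nonneg_matrix (a n)"
    and t: "\<And>i. (\<forall>k. 0 < mat_prod a t $ i $ k) \<or> (\<forall>k. mat_prod a t $ i $ k = 0)"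
  shows "\<forall>\<^sub>F n in sequentially. \<forall>i. row i (mat_prod a n) \<noteq> 0 \<longrightarrow> (\<forall>k. 0 < mat_prod a n $ i $ k)"
  unfolding eventually_sequentially
proof (intro exI[of _ t] allI impI)
  fix n i k assume "t \<le> n" and r: "row i (mat_prod a n) \<noteq> 0"
  then obtain m where n: "n = t + m" using le_Suc_ex by blast
  define C where "C = mat_prod (\<lambda>k. a (k + t)) m"
  have "nonneg_matrix C"
    unfolding C_def by (rule nonneg_mat_prod) (simp add: pos)
  then have C0: "0 \<le> C $ i $ l" for l by (simp add: nonneg_matrix_def)
  have M: "mat_prod a n $ i $ k = (\<Sum>l\<in>UNIV. C $ i $ l * mat_prod a t $ l $ k)" for k
    by (simp add: n mat_prod_add C_def matrix_matrix_mult_def)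
  have t0: "0 \<le> mat_prod a t $ l $ k" for l k using t[of l] by (auto simp: less_imp_le)
  obtain k' where "mat_prod a n $ i $ k' \<noteq> 0" using r by (auto simp: row_def vec_eq_iff)
  then obtain l where l: "C $ i $ l * mat_prod a t $ l $ k' \<noteq> 0" unfolding M by (meson sum.not_neutral_contains_not_neutral)
  then have "0 < mat_prod a t $ l $ k" using t[of l] by auto
  moreover have "0 < C $ i $ l" using l C0[of l] by (auto simp: less_le)
  ultimately have "0 < C $ i $ l * mat_prod a t $ l $ k" by simp
  also have "\<dots> \<le> mat_prod a n $ i $ k"
    unfolding M by (rule member_le_sum) (auto intro!: mult_nonneg_nonneg C0 t0)
  finally show "0 < mat_prod a n $ i $ k" .
qed

text \<open>The singular vectors are not assumed to be measurable in \<open>\<omega>\<close>. The normalized column sums of \<open>M\<^sub>n\<close> are,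
  and they have the same limit.\<close>

definition limit_direction :: "(nat \<Rightarrow> real^'p^'p) \<Rightarrow> real^'p" where
  "limit_direction a = lim (\<lambda>n. column_sums (mat_prod a n) /\<^sub>R norm (column_sums (mat_prod a n)))"

text \<open>The maximum is \<open>\<lambda>\<^sub>2\<close>: the projections of the unit vectors span the hyperplane orthogonal to \<open>v\<^sup>1\<close>.
  In this form the condition is visibly measurable, as Fubini's theorem requires.\<close>

definition generic_pair :: "(nat \<Rightarrow> real^'p^'p) \<Rightarrow> (real^'p) \<times> (real^'p) \<Rightarrow> bool" where
  "generic_pair a z \<longleftrightarrow> (let v = limit_direction a in
     Max (range (\<lambda>i. lyap a (axis i 1 - (v $ i) *\<^sub>R v)))
       \<le> lyap a ((v \<bullet> snd z) *\<^sub>R fst z - (v \<bullet> fst z) *\<^sub>R snd z))"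

text \<open>The vector y built from a pair is always orthogonal to v, so its exponent is at most l2
  and genericity means equality. Strict inequality would force c \<bullet> y = 0 for the exceptional
  functional c, a bilinear equation that holds only on a null set.\<close>

lemma (in dominated_products) generic_pair_iff_AE:
  obtains v where "norm v = 1" "\<And>i. 0 \<le> v $ i" "\<And>u. top_right_directions u \<Longrightarrow> u \<longlonglongrightarrow> v"
    "\<And>z. generic_pair a z \<longleftrightarrow> lyap a ((v \<bullet> snd z) *\<^sub>R fst z - (v \<bullet> fst z) *\<^sub>R snd z) = l2"
    "AE z in lborel. generic_pair a z"
proof -
  obtain v where v: "norm v = 1" "\<And>i. 0 \<le> v $ i" "lyap_space a l2 = {y. v \<bullet> y = 0}"
    "\<And>u. top_right_directions u \<Longrightarrow> u \<longlonglongrightarrow> v"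
    using normal_direction by blast
  have dir: "limit_direction a = v"
    unfolding limit_direction_def by (rule limI[OF v(4)[OF top_right_directions_column_sums]])
  let ?y = "\<lambda>z. (v \<bullet> snd z) *\<^sub>R fst z - (v \<bullet> fst z) *\<^sub>R snd z"
  have le: "lyap a (?y z) \<le> l2" for z
  proof -
    have "?y z \<in> lyap_space a l2" unfolding v(3) by (simp add: inner_diff_right)
    then show ?thesis by (simp add: lyap_space_def)
  qed
  have iff: "generic_pair a z \<longleftrightarrow> lyap a (?y z) = l2" for z
    unfolding generic_pair_def Let_def dir l2_eq_Max[OF v(1,3), symmetric] using le[of z] by auto
  obtain c where c: "\<And>y. lyap a y < l2 \<Longrightarrow> c \<bullet> y = 0"
    "\<And>w. v \<bullet> w \<noteq> 0 \<Longrightarrow> (v \<bullet> w) *\<^sub>R c - (c \<bullet> w) *\<^sub>R v \<noteq> 0"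
    using exceptional_functional[OF v(1,3)] by blast
  have bilinear: "AE z in lborel. v \<bullet> fst z \<noteq> 0 \<longrightarrow> (v \<bullet> snd z) * (c \<bullet> fst z) - (v \<bullet> fst z) * (c \<bullet> snd z) \<noteq> 0"
    by (rule AE_lborel_bilinear_neq_0) (rule c(2))
  have "(v, 0) \<noteq> (0 :: (real^'p) \<times> (real^'p))" using v(1) by (auto simp: zero_prod_def)
  from AE_lborel_inner_neq_0[OF this] bilinear
  have "AE z in lborel. generic_pair a z"
  proof eventually_elim
    case (elim z)
    then have "c \<bullet> ?y z \<noteq> 0" by (simp add: inner_diff_right inner_prod_def)
    then show "generic_pair a z" using c(1)[of "?y z"] le[of z] iff[of z] by force
  qed
  with v(1,2,4) iff that show thesis by blast
qed

lemma measurable_generic_pair: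
  fixes A :: "nat \<Rightarrow> 'a \<Rightarrow> real^'p^'p"
  assumes A: "\<And>n. n \<ge> 1 \<Longrightarrow> A n \<in> borel_measurable P"
  shows "{z \<in> space (P \<Otimes>\<^sub>M lborel). generic_pair (\<lambda>m. A m (fst z)) (snd z)} \<in> sets (P \<Otimes>\<^sub>M lborel)"
proof -
  let ?N = "P \<Otimes>\<^sub>M (lborel :: ((real^'p) \<times> (real^'p)) measure)"
  have A' [measurable]: "(\<lambda>z. A n (fst z)) \<in> borel_measurable ?N" if "n \<ge> 1" for n
    using measurable_compose[OF measurable_fst A[OF that]] .
  note borel_measurable_mat_prod_component[where A="\<lambda>n z. A n (fst z)", OF A', measurable]
  have [measurable]: "(\<lambda>z. column_sums (mat_prod (\<lambda>m. A m (fst z)) n)) \<in> borel_measurable ?N" for n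
    by (rule borel_measurable_vec_iff_components) (simp add: column_sums_def)
  define v where "v = (\<lambda>z :: 'a \<times> (real^'p) \<times> (real^'p). limit_direction (\<lambda>m. A m (fst z)))"
  have [measurable]: "(\<lambda>z. fst (snd z)) \<in> borel_measurable ?N" "(\<lambda>z. snd (snd z)) \<in> borel_measurable ?N"
    by (rule measurable_compose[OF measurable_snd];
        simp add: borel_measurable_continuous_onI continuous_on_fst continuous_on_snd)+
  have v: "limit_direction (\<lambda>m. A m (fst z)) = v z" for z by (simp add: v_def)
  \<comment> \<open>\<open>lim\<close> of measurable vectors is measurable also where the sequence
    diverges, so no exceptional \<omega> have to be removed first.\<close>
  have [measurable]: "(\<lambda>z. v z) \<in> borel_measurable ?N"
    unfolding v_def limit_direction_def by measurable
  have "(\<lambda>z. lyap (\<lambda>m. A m (fst z)) (axis i 1 - (v z $ i) *\<^sub>R v z)) \<in> borel_measurable ?N" for i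
    by (rule borel_measurable_lyap[where A="\<lambda>n z. A n (fst z)", OF A']) measurable
  then have [measurable]: "(\<lambda>z. Max (range (\<lambda>i. lyap (\<lambda>m. A m (fst z)) (axis i 1 - (v z $ i) *\<^sub>R v z)))) \<in> borel_measurable ?N"
    by (intro borel_measurable_Max) auto
  have [measurable]: "(\<lambda>z. lyap (\<lambda>m. A m (fst z)) ((v z \<bullet> snd (snd z)) *\<^sub>R fst (snd z) - (v z \<bullet> fst (snd z)) *\<^sub>R snd (snd z))) \<in> borel_measurable ?N"
    by (rule borel_measurable_lyap[where A="\<lambda>n z. A n (fst z)", OF A']) measurable
  show ?thesis
    unfolding generic_pair_def Let_def v by measurable
qed

theorem theorem1p11:
  fixes P :: "'a measure"
    and A :: "nat \<Rightarrow> 'a \<Rightarrow> real^('p::{finite,linorder})^('p::{finite,linorder})"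
    and M :: "nat \<Rightarrow> 'a \<Rightarrow> real^('p::{finite,linorder})^('p::{finite,linorder})"
    and lam :: "nat \<Rightarrow> 'a \<Rightarrow> ereal"
    and v :: "nat \<Rightarrow> 'a \<Rightarrow> real^('p::{finite,linorder})"
    and v1 :: "'a \<Rightarrow> real^('p::{finite,linorder})"
  assumes prob: "prob_space P"
    and dim: "CARD('p) \<ge> 2"
    and random: "\<And>n. n \<ge> 1 \<Longrightarrow> A n \<in> borel_measurable P"
    and nonneg: "AE \<omega> in P. \<forall>n\<ge>1. nonneg_matrix (A n \<omega>) \<and> column_allowable (A n \<omega>)"
    and stationary: "strictly_stationary P A"
    and ergodic: "ergodic_process P A"
    and primitive: "weakly_sequentially_primitive P A"
    and log_moment: "integrable P (\<lambda>\<omega>. ln (max 1 (norm (A 1 \<omega>))))"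
    and M_def: "\<And>n \<omega>. M n \<omega> = mat_prod (\<lambda>m. A m \<omega>) n"
    and lam_def: "\<And>k \<omega>. lam k \<omega> = lyapunov_exponent (\<lambda>m. A m \<omega>) k"
    and gap: "AE \<omega> in P. lam 1 \<omega> > lam 2 \<omega>"
    and subexp: "\<And>i j k. weakly_subexponential P (entry_ratio A i j k)"
    and v: "AE \<omega> in P. \<forall>n\<ge>1. leading_right_singular_vector (M n \<omega>) (v n \<omega>)"
    and v1_def: "\<And>\<omega>. v1 \<omega> = lim (\<lambda>n. v n \<omega>)"
  shows "AE (x, w) in lebesgue. x \<in> nonneg_vectors \<and> w \<in> nonneg_vectors \<longrightarrow>
           (AE \<omega> in P.
              limsup (\<lambda>n. elog (Max ((\<lambda>i. \<bar>(row i (M n \<omega>) \<bullet> x) / (row i (M n \<omega>) \<bullet> w)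
                                              - (v1 \<omega> \<bullet> x) / (v1 \<omega> \<bullet> w)\<bar>)
                                     ` {i. row i (M n \<omega>) \<noteq> 0}))
                          / ereal (real n))
              = - (lam 1 \<omega> - lam 2 \<omega>))"
proof -
  interpret prob_space P by (rule prob)
  define a where "a = (\<lambda>\<omega> m. A m \<omega>)"
  define R where "R = (\<lambda>z \<omega>. limsup (\<lambda>n. elog (Max ((\<lambda>i. \<bar>(row i (M n \<omega>) \<bullet> fst z) / (row i (M n \<omega>) \<bullet> snd z)
      - (v1 \<omega> \<bullet> fst z) / (v1 \<omega> \<bullet> snd z)\<bar>) ` {i. row i (M n \<omega>) \<noteq> 0})) / ereal (real n))
      = - (lam 1 \<omega> - lam 2 \<omega>))"
  have M: "M n \<omega> = mat_prod (a \<omega>) n" for n \<omega> by (simp add: M_def a_def)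
  have lims: "AE \<omega> in P. limsup (\<lambda>n. ereal (ln (entry_sum (mat_prod (a \<omega>) n)) / real n))
        \<le> liminf (\<lambda>n. ereal (ln (entry_sum (mat_prod (a \<omega>) n)) / real n)) \<and>
      limsup (\<lambda>n. ereal (ln (entry_sum (mat_prod (a \<omega>) n)) / real n)) < \<infinity>"
    unfolding a_def by (rule AE_ln_entry_sum_limit[OF prob random nonneg stationary log_moment])
  have gap': "AE \<omega> in P. lyapunov_exponent (a \<omega>) 2 < lyapunov_exponent (a \<omega>) 1"
    using gap by (simp add: lam_def a_def)
  have rows: "AE \<omega> in P. \<exists>t. \<forall>i. (\<forall>k. 0 < mat_prod (a \<omega>) t $ i $ k) \<or> (\<forall>k. mat_prod (a \<omega>) t $ i $ k = 0)"
  proof -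
    obtain \<tau> :: "'a \<Rightarrow> enat" where "AE \<omega> in P. 1 \<le> \<tau> \<omega> \<and> \<tau> \<omega> < \<infinity> \<and>
           (\<forall>i. (\<forall>k. 0 < mat_prod (\<lambda>n. A n \<omega>) (the_enat (\<tau> \<omega>)) $ i $ k)
              \<or> (\<forall>k. mat_prod (\<lambda>n. A n \<omega>) (the_enat (\<tau> \<omega>)) $ i $ k = 0))"
      using primitive unfolding weakly_sequentially_primitive_def by blast
    then show ?thesis by eventually_elim (auto simp: a_def)
  qed
  \<comment> \<open>Countably many rates 1 / (m + 1) and finitely many indices leave one null set
    for all \<epsilon>.\<close>
  have ratio: "AE \<omega> in P. \<forall>m i j k. \<forall>\<^sub>F n in sequentially.
      \<bar>entry_ratio A i j k n \<omega>\<bar> \<le> ereal (exp (inverse (real (Suc m)) * real n)) \<or> entry_ratio A i j k n \<omega> = \<infinity>"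
    unfolding AE_all_countable using subexp by (simp add: weakly_subexponential_def)
  have "AE \<omega> in P. (AE z in lborel. generic_pair (a \<omega>) z) \<and>
      (\<forall>z. (\<forall>i. 0 < fst z $ i) \<and> (\<forall>i. 0 < snd z $ i) \<and> generic_pair (a \<omega>) z \<longrightarrow> R z \<omega>)"
    using nonneg lims gap' rows ratio v
  proof eventually_elim
    case (elim \<omega>)
    have pos: "nonneg_matrix (a \<omega> n) \<and> column_allowable (a \<omega> n)" if "n \<ge> 1" for n
      using elim(1) that by (simp add: a_def)
    obtain l1 where l1: "lyapunov_exponent (a \<omega>) 1 = ereal l1"
      and dom: "dominated_products (a \<omega>) l1 (lyapunov_exponent (a \<omega>) 2)"
      by (rule dominated_products_of_gap[OF dim elim(3) pos]) (use elim(2) in auto)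
    interpret dominated_products "a \<omega>" l1 "lyapunov_exponent (a \<omega>) 2" by (rule dom)
    obtain d where d: "norm d = 1" "\<And>i. 0 \<le> d $ i" "\<And>u. top_right_directions u \<Longrightarrow> u \<longlonglongrightarrow> d"
      "\<And>z. generic_pair (a \<omega>) z \<longleftrightarrow> lyap (a \<omega>) ((d \<bullet> snd z) *\<^sub>R fst z - (d \<bullet> fst z) *\<^sub>R snd z) = lyapunov_exponent (a \<omega>) 2"
      "AE z in lborel. generic_pair (a \<omega>) z"
      using generic_pair_iff_AE by blast
    have "top_right_directions (\<lambda>n. v n \<omega>)"
      unfolding top_right_directions_def
    proof (intro conjI exI)
      have sv: "leading_right_singular_vector (mat_prod (a \<omega>) n) (v n \<omega>)" if "n \<ge> 1" for n
        using elim(6) that by (simp add: M)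
      show "\<forall>\<^sub>F n in sequentially. norm (v n \<omega>) = 1 \<and> (\<forall>i. 0 \<le> v n \<omega> $ i)"
        using eventually_ge_at_top[of 1]
      proof eventually_elim
        case (elim n)
        then show ?case
          using sv[of n] norm_leading_right_singular_vector unfolding leading_right_singular_vector_def by blast
      qed
      show "\<forall>\<^sub>F n in sequentially. \<forall>y. E n * \<bar>v n \<omega> \<bullet> y\<bar> \<le> (real CARD('p))\<^sup>2 * norm (mat_prod (a \<omega>) n *v y)"
        using eventually_ge_at_top[of 1]
        by eventually_elim (use sv abs_inner_leading_right_singular_vector_le nonneg_prod in blast)
    qed
    \<comment> \<open>Whatever decompositions were chosen, the limit is the normal of the slow
      hyperplane.\<close>
    then have v1: "v1 \<omega> = d" unfolding v1_def by (intro limI d(3))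
    have rows': "\<forall>\<^sub>F n in sequentially. \<forall>i. row i (mat_prod (a \<omega>) n) \<noteq> 0 \<longrightarrow> (\<forall>k. 0 < mat_prod (a \<omega>) n $ i $ k)"
      using elim(4) eventually_rows_positive[of "a \<omega>"] pos by blast
    have ratios': "\<forall>\<^sub>F n in sequentially. \<forall>i j k. mat_prod (a \<omega>) n $ j $ k \<noteq> 0 \<longrightarrow>
        mat_prod (a \<omega>) n $ i $ k \<le> exp (e * real n) * mat_prod (a \<omega>) n $ j $ k" if e: "0 < e" for e
    proof -
      obtain m where m: "inverse (real (Suc m)) < e" using reals_Archimedean[OF e] by blast
      have "\<forall>\<^sub>F n in sequentially. \<forall>i j k. \<bar>entry_ratio A i j k n \<omega>\<bar> \<le> ereal (exp (inverse (real (Suc m)) * real n)) \<or> entry_ratio A i j k n \<omega> = \<infinity>"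
        using elim(5) by (simp add: eventually_all_finite)
      then show ?thesis
      proof eventually_elim
        case (elim n)
        show ?case
        proof (intro allI impI)
          fix i j k assume nz: "mat_prod (a \<omega>) n $ j $ k \<noteq> 0"
          let ?x = "mat_prod (a \<omega>) n $ i $ k" and ?y = "mat_prod (a \<omega>) n $ j $ k"
          have y: "0 < ?y" using nz nonneg_prod[of n] by (auto simp: nonneg_matrix_def less_le)
          have er: "entry_ratio A i j k n \<omega> = ereal (?x / ?y)"
            using nz by (simp add: entry_ratio_def a_def)
          \<comment> \<open>The alternative \<infinity> is excluded because the denominator is
            nonzero and the ratio real.\<close>
          have "?x / ?y \<le> exp (inverse (real (Suc m)) * real n)"
            using elim[rule_format, of i j k] unfolding er by (auto simp: abs_le_iff simp del: abs_divide)
          also have "\<dots> \<le> exp (e * real n)" using m by (simp add: mult_right_mono)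
          finally show "?x \<le> exp (e * real n) * ?y" using y by (simp add: field_simps)
        qed
      qed
    qed
    have "R z \<omega>" if z: "\<forall>i. 0 < fst z $ i" "\<forall>i. 0 < snd z $ i" "generic_pair (a \<omega>) z" for z
    proof -
      have "d \<noteq> 0" using d(1) by auto
      then obtain i where "d $ i \<noteq> 0" by (auto simp: vec_eq_iff)
      then have "0 < d $ i * snd z $ i" using d(2)[of i] z(2) by (simp add: less_le)
      also have "\<dots> \<le> d \<bullet> snd z"
        unfolding inner_vec_def inner_real_def
        by (rule member_le_sum) (use z(2) d(2) in \<open>auto intro!: mult_nonneg_nonneg simp: less_imp_le\<close>)
      finally have dw: "0 < d \<bullet> snd z" .
      show ?thesis
        unfolding R_def M v1 lam_def using limsup_ratio_error[OF rows' ratios' dw, of "fst z"] z(2,3) d(4)[of z] l1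
        by (simp add: a_def)
    qed
    with d(5) show ?case by blast
  qed
  \<comment> \<open>Only the first half goes through Fubini. The second holds for all pairs
    simultaneously outside one null set of \<omega>, so it can be specialized to any z without
    measurability of \<open>R\<close>.\<close>
  then have path: "AE \<omega> in P. AE z in lborel. generic_pair (a \<omega>) z"
    and conv: "AE \<omega> in P. \<forall>z. (\<forall>i. 0 < fst z $ i) \<and> (\<forall>i. 0 < snd z $ i) \<and> generic_pair (a \<omega>) z \<longrightarrow> R z \<omega>"
    by (auto elim: eventually_mono)
  interpret pair_sigma_finite P
    "lborel :: ((real^('p::{finite,linorder})) \<times> (real^('p::{finite,linorder}))) measure" ..
  \<comment> \<open>After the exchange the null set of pairs no longer depends on \<omega>.\<close>
  have "AE z in lborel. AE \<omega> in P. generic_pair (a \<omega>) z"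
    using path measurable_generic_pair[where A=A and P=P, OF random]
    by (subst (asm) AE_commute) (simp_all add: a_def)
  then have "AE z in lborel. fst z \<in> nonneg_vectors \<and> snd z \<in> nonneg_vectors \<longrightarrow> (AE \<omega> in P. R z \<omega>)"
    using AE_lborel_nonneg_vectors_pos
  proof eventually_elim
    case (elim z)
    show ?case
    proof
      assume "fst z \<in> nonneg_vectors \<and> snd z \<in> nonneg_vectors"
      then have z: "\<forall>i. 0 < fst z $ i" "\<forall>i. 0 < snd z $ i" using elim(2) by auto
      from elim(1) conv show "AE \<omega> in P. R z \<omega>"
        by eventually_elim (use z in blast)
    qed
  qed
  then have "AE z in lebesgue. fst z \<in> nonneg_vectors \<and> snd z \<in> nonneg_vectors \<longrightarrow> (AE \<omega> in P. R z \<omega>)"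
    by (rule AE_completion)
  then show ?thesis by (simp add: R_def case_prod_beta')
qed

end
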